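(* Let $p>3$ be a prime. Then $$\sum_{k=0}^{p-1}\frac{\binom{6k}{3k}\binom{3k}{k}}{432^k(2k+1)}\equiv \Big(\frac p3\Big)-\frac{25}4p^2U_{p-3}\pmod{p^3}.$$
   Context: For $x,y\in\mathbb Q$ with denominators prime to $p$, $x\equiv y\pmod{p^m}$ means $(x-y)/p^m$ has denominator prime to $p$. $\big(\frac p3\big)$ is the Legendre symbol. The sequence $\{U_n\}$ is defined by $U_0=1$ and $U_n=-2\sum_{k=1}^{[n/2]}\binom n{2k}U_{n-2k}$ for $n\ge1$. *)

theory Defs
  imports Complex_Main "HOL-Number_Theory.Number_Theory"
begin

definition p_integral :: "nat \<Rightarrow> rat \<Rightarrow> bool" where
  "p_integral p x \<longleftrightarrow> coprime (snd (quotient_of x)) (int p)"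

text \<open>Congruence of rationals modulo \<open>p ^ m\<close>. The congruence is only meaningful
  for rationals with denominator prime to \<open>p\<close>, so this is made part of the relation.\<close>

definition rat_cong :: "nat \<Rightarrow> nat \<Rightarrow> rat \<Rightarrow> rat \<Rightarrow> bool" where
  "rat_cong p m x y \<longleftrightarrow>
     p_integral p x \<and> p_integral p y \<and> p_integral p ((x - y) / of_nat p ^ m)"

function U :: "nat \<Rightarrow> int" where
  "U n = (if n = 0 then 1
          else - 2 * (\<Sum>k = 1..n div 2. int (n choose (2 * k)) * U (n - 2 * k)))"
  by auto
termination
  by (relation "measure id") auto

declare U.simps [simp del]

end

theory Submission
  imports Defs "HOL-Computational_Algebra.Polynomial"
begin

text \<open>
  Put \<open>F(a,k) = binom(a,k) binom(-1-a,k)\<close>, so that the summand is \<open>F(-1/6,k) / (2k+1)\<close>, and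
  \<open>M(a) = (2a+1) \<Sum>\<^sub>k F(a,k) / (2k+1)\<close> with \<open>k < p\<close>. Then
  \<open>M(a) - M(a-1) = 2 R(a)\<close> with \<open>R(a) = \<Prod>\<^sub>i (1 - a\<^sup>2/i\<^sup>2)\<close>, \<open>0 < i < p\<close>.
  Modulo \<open>p\<^sup>3\<close> one has \<open>R(pt) = 1\<close> and \<open>R(pt+c) = p\<^sup>2 t(t+1) / c\<^sup>2\<close> for \<open>0 < c < p\<close>.
  As \<open>M(pt)\<close> is a cubic polynomial in \<open>t\<close> modulo \<open>p\<^sup>3\<close> that agrees with \<open>1 + 2t\<close> at all natural
  numbers, it equals \<open>1 + 2t\<close>. Writing \<open>-1/6 = pt + r\<close> with \<open>0 \<le> r < p\<close> therefore gives
  \<open>M(-1/6) = 1 + 2t + 2 p\<^sup>2 t(t+1) H\<close>, where \<open>H\<close> is the sum of \<open>c\<^sup>p\<^sup>-\<^sup>3\<close> over \<open>c \<le> r\<close>.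

  The polynomials \<open>V(x) = \<Sum>\<^sub>k binom(n,k) U\<^sub>k x\<^sup>n\<^sup>-\<^sup>k\<close> satisfy \<open>V(x+1) - V(x) + V(x-1) = x\<^sup>n\<close>. For
  \<open>n = p - 3\<close> a combination of power sums at \<open>(x+j)/6\<close> satisfies the same recurrence modulo \<open>p\<close>, up
  to the factor 36; comparing the two at \<open>x = 0\<close> yields \<open>H = 15 U\<^sub>n\<close> modulo \<open>p\<close>.
\<close>

section \<open>Rationals with denominator prime to p\<close>

text \<open>The reduced denominator divides the denominator of any other representation, so closure
  under the ring operations can be shown with arbitrary fractions instead of
  \<open>quotient_of\<close>.\<close>

lemma p_integral_iff:
  assumes "prime p"
  shows "p_integral p x \<longleftrightarrow> (\<exists>a b. coprime b (int p) \<and> x = of_int a / of_int b)"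
proof
  assume "p_integral p x"
  moreover obtain a b where ab: "quotient_of x = (a, b)" by force
  ultimately have "coprime b (int p)" by (simp add: p_integral_def)
  moreover have "x = of_int a / of_int b" using quotient_of_div[OF ab] .
  ultimately show "\<exists>a b. coprime b (int p) \<and> x = of_int a / of_int b" by blast
next
  assume "\<exists>a b. coprime b (int p) \<and> x = of_int a / of_int b"
  then obtain a b where b: "coprime b (int p)" and x: "x = of_int a / of_int b" by blast
  obtain c d where cd: "quotient_of x = (c, d)" by force
  have d: "d > 0" "coprime c d" "x = of_int c / of_int d"
    using quotient_of_denom_pos[OF cd] quotient_of_coprime[OF cd] quotient_of_div[OF cd] .
  have "b \<noteq> 0" using b assms by (auto simp: prime_nat_iff)
  then have "(of_int (c * b) :: rat) = of_int (a * d)"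
    using d x by (simp add: field_simps)
  then have "c * b = a * d" by (simp only: of_int_eq_iff)
  then have "d dvd c * b" by simp
  then have "d dvd b" using d(2) by (simp add: coprime_dvd_mult_right_iff coprime_commute)
  then have "coprime d (int p)" using b by (meson coprime_divisors dvd_refl)
  then show "p_integral p x" by (simp add: p_integral_def cd)
qed

section \<open>Closure properties and the congruence calculus for rationals\<close>

context
  fixes p :: nat
  assumes prime: "prime p"
begin

lemma p_integral_of_int [simp]: "p_integral p (of_int a)"
  unfolding p_integral_iff[OF prime] by (rule exI[of _ a], rule exI[of _ 1]) simp

lemma p_integral_of_nat [simp]: "p_integral p (of_nat a)"
  using p_integral_of_int[of "int a"] by simp

lemma p_integral_0 [simp]: "p_integral p 0" and p_integral_1 [simp]: "p_integral p 1"
  and p_integral_numeral [simp]: "p_integral p (numeral w)"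
  using p_integral_of_int[of 0] p_integral_of_int[of 1] p_integral_of_int[of "numeral w"] by simp_all

lemma p_integral_mult [simp]:
  assumes "p_integral p x" "p_integral p y"
  shows "p_integral p (x * y)"
proof -
  obtain a b c d where "coprime b (int p)" "x = of_int a / of_int b"
    and "coprime d (int p)" "y = of_int c / of_int d"
    using assms unfolding p_integral_iff[OF prime] by blast
  then have "coprime (b * d) (int p)" "x * y = of_int (a * c) / of_int (b * d)" by simp_all
  then show ?thesis unfolding p_integral_iff[OF prime] by blast
qed

lemma p_integral_add [simp]:
  assumes "p_integral p x" "p_integral p y"
  shows "p_integral p (x + y)"
proof -
  obtain a b c d where bd: "coprime b (int p)" "x = of_int a / of_int b"
    "coprime d (int p)" "y = of_int c / of_int d"
    using assms unfolding p_integral_iff[OF prime] by blast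
  then have "b \<noteq> 0" "d \<noteq> 0" using prime by (auto simp: prime_nat_iff)
  then have "coprime (b * d) (int p)" "x + y = of_int (a * d + c * b) / of_int (b * d)"
    using bd by (simp_all add: field_simps)
  then show ?thesis unfolding p_integral_iff[OF prime] by blast
qed

lemma p_integral_minus [simp]: "p_integral p x \<Longrightarrow> p_integral p (- x)"
  using p_integral_mult[of "of_int (- 1)" x] p_integral_of_int[of "- 1"] by simp

lemma p_integral_diff [simp]:
  "p_integral p x \<Longrightarrow> p_integral p y \<Longrightarrow> p_integral p (x - y)"
  using p_integral_add[of x "- y"] by simp

lemma p_integral_power [simp]: "p_integral p x \<Longrightarrow> p_integral p (x ^ k)"
  by (induction k) simp_all

lemma p_integral_sum: "(\<And>i. i \<in> A \<Longrightarrow> p_integral p (f i)) \<Longrightarrow> p_integral p (sum f A)"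
  by (induction A rule: infinite_finite_induct) simp_all

lemma p_integral_inverse:
  assumes "\<not> p dvd k"
  shows "p_integral p (1 / of_nat k)"
proof -
  have "coprime (int k) (int p)"
    using prime_imp_coprime[OF prime assms] by (simp add: coprime_commute)
  then show ?thesis unfolding p_integral_iff[OF prime]
    by (intro exI[of _ 1] exI[of _ "int k"]) simp
qed

text \<open>Unlike \<open>rat_cong\<close>, this asks nothing of \<open>x\<close> and
  \<open>y\<close> separately, so it applies to sums whose integrality is only established at the
  end. The witness \<open>z\<close> turns a congruence into an equation that can be
  substituted.\<close>

definition pcong :: "nat \<Rightarrow> rat \<Rightarrow> rat \<Rightarrow> bool" where
  "pcong m x y \<longleftrightarrow> (\<exists>z. p_integral p z \<and> x = y + of_nat p ^ m * z)"

lemma pcong_iff: "pcong m x y \<longleftrightarrow> p_integral p ((x - y) / of_nat p ^ m)"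
proof -
  have "of_nat p ^ m \<noteq> (0 :: rat)" using prime by auto
  then have "x = y + of_nat p ^ m * z \<longleftrightarrow> z = (x - y) / of_nat p ^ m" for z
    by (auto simp: field_simps)
  then show ?thesis unfolding pcong_def by auto
qed

lemma pcong_refl [simp]: "pcong m x x"
  by (simp add: pcong_iff)

lemma pcong_sym: "pcong m x y \<Longrightarrow> pcong m y x"
  unfolding pcong_iff using p_integral_minus[of "(x - y) / of_nat p ^ m"]
  by (simp add: minus_divide_left)

lemma pcong_trans: "pcong m x y \<Longrightarrow> pcong m y z \<Longrightarrow> pcong m x z"
  unfolding pcong_def by (metis (no_types, lifting) p_integral_add add.assoc distrib_left)

lemma pcong_add: "pcong m x y \<Longrightarrow> pcong m x' y' \<Longrightarrow> pcong m (x + x') (y + y')"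
  unfolding pcong_iff using p_integral_add[of "(x - y) / of_nat p ^ m" "(x' - y') / of_nat p ^ m"]
  by (simp add: add_divide_distrib[symmetric] algebra_simps)

lemma pcong_mult_left:
  assumes "p_integral p c" "pcong m x y"
  shows "pcong m (c * x) (c * y)"
  using p_integral_mult[of c "(x - y) / of_nat p ^ m"] assms
  unfolding pcong_iff by (simp add: algebra_simps)

lemma pcong_diff: "pcong m x y \<Longrightarrow> pcong m x' y' \<Longrightarrow> pcong m (x - x') (y - y')"
  using pcong_add[of m x y "- x'" "- y'"] pcong_mult_left[of "- 1" m x' y'] by simp

lemma pcong_sum:
  "(\<And>i. i \<in> A \<Longrightarrow> pcong m (f i) (g i)) \<Longrightarrow> pcong m (sum f A) (sum g A)"
  by (induction A rule: infinite_finite_induct) (simp_all add: pcong_add)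

text \<open>Used with \<open>k = 2\<close>: a cofactor of \<open>p^2\<close> has to be known only
  modulo \<open>p\<close> in order to work modulo \<open>p^3\<close>.\<close>

lemma pcong_power_mult:
  assumes "pcong j x y"
  shows "pcong (k + j) (of_nat p ^ k * x) (of_nat p ^ k * y)"
proof -
  obtain z where "p_integral p z" "x = y + of_nat p ^ j * z" using assms unfolding pcong_def by blast
  then show ?thesis unfolding pcong_def by (intro exI[of _ z]) (simp add: algebra_simps power_add)
qed

lemma pcong_1_of_int:
  assumes "[a = b] (mod int p)"
  shows "pcong 1 (of_int a) (of_int b)"
proof -
  obtain c where "a = b + int p * c" using assms by (metis cong_iff_lin cong_sym)
  then show ?thesis unfolding pcong_def by (intro exI[of _ "of_int c"]) simp
qed

end

section \<open>The numbers U and power sums modulo p\<close>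

lemma binomial_even_part:
  fixes y :: int
  shows "(y + 1) ^ N + (y - 1) ^ N = (\<Sum>j\<le>N. int (N choose j) * (1 + (- 1) ^ j) * y ^ (N - j))"
proof -
  have "(y + 1) ^ N = (\<Sum>j\<le>N. int (N choose j) * 1 ^ j * y ^ (N - j))"
    using binomial_ring[of 1 y N] by (simp add: add.commute)
  moreover have "(y - 1) ^ N = (\<Sum>j\<le>N. int (N choose j) * (- 1) ^ j * y ^ (N - j))"
    using binomial_ring[of "- 1" y N] by simp
  ultimately show ?thesis by (simp add: sum.distrib[symmetric] algebra_simps)
qed

text \<open>If u is the exponential generating function of \<open>U\<close>, the recursion says (e^x
  + e^(-x)) u = u + 1; these are the coefficients. The weight \<open>1 + (- 1) ^ j\<close> removes
  the odd \<open>j\<close> while keeping the index set an interval.\<close>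

lemma U_convolution:
  "(\<Sum>j\<le>m. int (m choose j) * (1 + (- 1) ^ j) * U (m - j)) = U m + of_bool (m = 0)"
proof (cases "m = 0")
  case True
  then show ?thesis by (simp add: U.simps)
next
  case False
  have "(\<Sum>j\<le>m. int (m choose j) * (1 + (- 1) ^ j) * U (m - j))
      = (\<Sum>j\<in>(\<lambda>k. 2 * k) ` {0..m div 2}. int (m choose j) * (1 + (- 1) ^ j) * U (m - j))"
  proof (rule sum.mono_neutral_right)
    show "\<forall>j\<in>{..m} - (\<lambda>k. 2 * k) ` {0..m div 2}. int (m choose j) * (1 + (- 1) ^ j) * U (m - j) = 0"
    proof
      fix j assume "j \<in> {..m} - (\<lambda>k. 2 * k) ` {0..m div 2}"
      then have "odd j" by (auto elim!: evenE simp: image_iff)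
      then show "int (m choose j) * (1 + (- 1) ^ j) * U (m - j) = 0" by simp
    qed
  qed auto
  also have "\<dots> = (\<Sum>k = 0..m div 2. int (m choose (2 * k)) * 2 * U (m - 2 * k))"
    by (subst sum.reindex) (auto simp: inj_on_def)
  also have "\<dots> = 2 * U m + 2 * (\<Sum>k = 1..m div 2. int (m choose (2 * k)) * U (m - 2 * k))"
    by (subst sum.atLeast_Suc_atMost) (simp_all add: sum_distrib_left mult_ac)
  also have "\<dots> = U m" using False U.simps[of m] by simp
  finally show ?thesis using False by simp
qed

text \<open>The Appell polynomials of \<open>U\<close>, called V in the overview, with exponential
  generating function e^(xy) / (e^x + e^(-x) - 1).\<close>

definition U_poly :: "nat \<Rightarrow> int \<Rightarrow> int" where
  "U_poly n y = (\<Sum>k\<le>n. int (n choose k) * U k * y ^ (n - k))"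

text \<open>Expanding both powers and collecting by m = k + j leaves \<open>U_convolution\<close> as
  inner sum. Its term \<open>U m\<close> rebuilds the polynomial, and its extra 1 at m = 0 gives
  \<open>y ^ n\<close>.\<close>

lemma U_poly_recurrence: "U_poly n (y + 1) - U_poly n y + U_poly n (y - 1) = y ^ n"
proof -
  have "U_poly n (y + 1) + U_poly n (y - 1)
      = (\<Sum>k\<le>n. int (n choose k) * U k * ((y + 1) ^ (n - k) + (y - 1) ^ (n - k)))"
    by (simp add: U_poly_def sum.distrib[symmetric] algebra_simps)
  also have "\<dots> = (\<Sum>k\<le>n. \<Sum>j\<le>n - k. int (n choose k) * int ((n - k) choose j) * U k
                    * (1 + (- 1) ^ j) * y ^ (n - (k + j)))"
    by (simp add: binomial_even_part sum_distrib_left mult_ac diff_diff_left)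
  also have "\<dots> = (\<Sum>(k, j)\<in>{(k, j). k + j \<le> n}. int (n choose k) * int ((n - k) choose j) * U k
                    * (1 + (- 1) ^ j) * y ^ (n - (k + j)))"
    by (subst sum.Sigma) (auto intro!: sum.cong)
  also have "\<dots> = (\<Sum>m\<le>n. \<Sum>i\<le>m. int (n choose i) * int ((n - i) choose (m - i)) * U i
                    * (1 + (- 1) ^ (m - i)) * y ^ (n - m))"
    by (subst sum.triangle_reindex_eq) simp
  also have "\<dots> = (\<Sum>m\<le>n. int (n choose m) * y ^ (n - m)
                    * (\<Sum>j\<le>m. int (m choose j) * (1 + (- 1) ^ j) * U (m - j)))"
  proof (rule sum.cong[OF refl])
    fix m assume m: "m \<in> {..n}"
    have "(\<Sum>i\<le>m. int (n choose i) * int ((n - i) choose (m - i)) * U i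
                    * (1 + (- 1) ^ (m - i)) * y ^ (n - m))
        = (\<Sum>i\<le>m. int (n choose m) * y ^ (n - m) * (int (m choose i) * (1 + (- 1) ^ (m - i)) * U i))"
    proof (rule sum.cong[OF refl])
      fix i assume "i \<in> {..m}"
      then have "(n choose i) * ((n - i) choose (m - i)) = (n choose m) * (m choose i)"
        using m choose_mult[of i m n] by simp
      then have "int (n choose i) * int ((n - i) choose (m - i)) = int (n choose m) * int (m choose i)"
        by (metis of_nat_mult)
      then show "int (n choose i) * int ((n - i) choose (m - i)) * U i * (1 + (- 1) ^ (m - i)) * y ^ (n - m)
          = int (n choose m) * y ^ (n - m) * (int (m choose i) * (1 + (- 1) ^ (m - i)) * U i)"
        by (simp add: algebra_simps)
    qed
    also have "\<dots> = int (n choose m) * y ^ (n - m)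
                    * (\<Sum>i\<le>m. int (m choose i) * (1 + (- 1) ^ (m - i)) * U i)"
      by (simp add: sum_distrib_left)
    also have "(\<Sum>i\<le>m. int (m choose i) * (1 + (- 1) ^ (m - i)) * U i)
        = (\<Sum>j\<le>m. int (m choose j) * (1 + (- 1) ^ j) * U (m - j))"
      by (rule sum.reindex_bij_witness[of _ "\<lambda>i. m - i" "\<lambda>i. m - i"])
        (auto simp: binomial_symmetric[symmetric])
    finally show "(\<Sum>i\<le>m. int (n choose i) * int ((n - i) choose (m - i)) * U i
                    * (1 + (- 1) ^ (m - i)) * y ^ (n - m)) = int (n choose m) * y ^ (n - m)
                    * (\<Sum>j\<le>m. int (m choose j) * (1 + (- 1) ^ j) * U (m - j))" .
  qed
  also have "\<dots> = (\<Sum>m\<le>n. int (n choose m) * U m * y ^ (n - m))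
                 + (\<Sum>m\<le>n. if m = 0 then y ^ n else 0)"
    unfolding U_convolution sum.distrib[symmetric] by (intro sum.cong) (auto simp: algebra_simps)
  also have "\<dots> = U_poly n y + y ^ n" by (simp add: U_poly_def)
  finally show ?thesis by simp
qed

lemma U_poly_0: "U_poly n 0 = U n"
proof -
  have "U_poly n 0 = (\<Sum>k\<le>n. if k = n then U n else 0)"
    unfolding U_poly_def by (intro sum.cong) (auto simp: power_0_left)
  then show ?thesis by simp
qed

lemma U_poly_cong: "[x = y] (mod m) \<Longrightarrow> [U_poly n x = U_poly n y] (mod m)"
  unfolding U_poly_def by (intro cong_sum cong_mult cong_refl cong_pow)

text \<open>The bound is exclusive, so the sum up to r is \<open>power_sum n (Suc r)\<close>. For a
  positive exponent such as p - 3 the term i = 0 vanishes.\<close>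

definition power_sum :: "nat \<Rightarrow> nat \<Rightarrow> int" where
  "power_sum n N = (\<Sum>i<N. int i ^ n)"

lemma power_sum_0 [simp]: "power_sum n 0 = 0"
  and power_sum_Suc: "power_sum n (Suc N) = power_sum n N + int N ^ n"
  by (simp_all add: power_sum_def)

section \<open>Power sums with exponent p - 3 as functions on residue classes\<close>

context
  fixes p :: nat
  assumes prime: "prime p" and p_gt_3: "p > 3"
begin

lemma not_p_dvd_small: "0 < k \<Longrightarrow> k < p \<Longrightarrow> \<not> p dvd k"
  using nat_dvd_not_less by blast

lemma odd_p: "odd p"
  using prime p_gt_3 prime_odd_nat by simp

text \<open>By Fermat the exponent p - 3 acts as -2 modulo p, which is why it appears in all power
  sums below.\<close>

lemma square_mult_power:
  assumes "\<not> p dvd k"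
  shows "[int k ^ 2 * int k ^ (p - 3) = 1] (mod int p)"
proof -
  have "[k ^ (p - 1) = 1] (mod p)" using fermat_theorem[OF prime assms] .
  then have "[int k ^ (p - 1) = 1] (mod int p)" by (metis cong_int_iff of_nat_1 of_nat_power)
  moreover have "int k ^ 2 * int k ^ (p - 3) = int k ^ (p - 1)"
    using p_gt_3 by (subst power_add[symmetric]) (rule arg_cong[of _ _ "\<lambda>e. int k ^ e"], simp)
  ultimately show ?thesis by simp
qed

lemma cong_cancel_small:
  assumes "0 < k" "k < p" "[int k * x = int k * y] (mod int p)"
  shows "[x = y] (mod int p)"
proof -
  have "coprime (int k) (int p)"
    using prime assms(1,2) not_p_dvd_small prime_imp_coprime coprime_commute by (metis coprime_int_iff)
  then show ?thesis using assms(3) cong_mult_lcancel by blast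
qed

text \<open>Doubling permutes the residues, so the sum is fixed by multiplication with \<open>2 ^ (p - 3)\<close>, which is \<open>1/4\<close>.\<close>
lemma power_sum_full: "[power_sum (p - 3) p = 0] (mod int p)"
proof -
  let ?n = "p - 3"
  have 4: "[4 * 2 ^ ?n = 1] (mod int p)"
    using square_mult_power[OF not_p_dvd_small[of 2]] p_gt_3 by simp
  have inj: "inj_on (\<lambda>i. 2 * i mod p) {..<p}"
  proof (rule inj_onI)
    fix i j assume ij: "i \<in> {..<p}" "j \<in> {..<p}" "2 * i mod p = 2 * j mod p"
    have "[2 * i = 2 * j] (mod p)" using ij(3) by (simp add: cong_def)
    moreover have "coprime 2 p" using odd_p by simp
    ultimately have "[i = j] (mod p)" using cong_mult_lcancel_nat by blast
    then show "i = j" using ij by (simp add: cong_def)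
  qed
  have "(\<lambda>i. 2 * i mod p) ` {..<p} = {..<p}"
    using prime prime_gt_0_nat by (intro endo_inj_surj[OF _ _ inj]) auto
  then have "power_sum ?n p = (\<Sum>i<p. int (2 * i mod p) ^ ?n)"
    unfolding power_sum_def using sum.reindex[OF inj, of "\<lambda>i. int i ^ ?n"] by simp
  also have "[(\<Sum>i<p. int (2 * i mod p) ^ ?n) = (\<Sum>i<p. 2 ^ ?n * int i ^ ?n)] (mod int p)"
    unfolding power_mult_distrib[symmetric]
    by (intro cong_sum cong_pow) (simp add: zmod_int)
  also have "(\<Sum>i<p. 2 ^ ?n * int i ^ ?n) = 2 ^ ?n * power_sum ?n p"
    by (simp add: power_sum_def sum_distrib_left)
  finally have "[4 * power_sum ?n p = 4 * 2 ^ ?n * power_sum ?n p] (mod int p)"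
    by (simp add: cong_scalar_left mult.assoc)
  also have "[4 * 2 ^ ?n * power_sum ?n p = 1 * power_sum ?n p] (mod int p)"
    by (intro cong_scalar_right 4)
  finally have "[int 3 * power_sum ?n p = int 3 * 0] (mod int p)"
    by (simp add: cong_iff_dvd_diff)
  then show ?thesis by (rule cong_cancel_small[rotated 2]) (use p_gt_3 in auto)
qed

lemma power_sum_add_p: "[power_sum (p - 3) (N + p) = power_sum (p - 3) N] (mod int p)"
proof (induction N)
  case 0
  then show ?case using power_sum_full by simp
next
  case (Suc N)
  have "[int (N + p) ^ (p - 3) = int N ^ (p - 3)] (mod int p)"
    by (intro cong_pow) (simp add: cong_def)
  then show ?case using cong_add[OF Suc.IH] by (simp add: power_sum_Suc)
qed

text \<open>Adding p to the bound adds a full period, whose sum is zero. Hence the power sum may be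
  evaluated at residues standing for fractions such as 1/6.\<close>

lemma power_sum_cong:
  assumes "[M = N] (mod p)"
  shows "[power_sum (p - 3) M = power_sum (p - 3) N] (mod int p)"
proof -
  have step: "[power_sum (p - 3) (K + k * p) = power_sum (p - 3) K] (mod int p)" for K k
  proof (induction k)
    case (Suc k)
    then show ?case using power_sum_add_p[of "K + k * p"] by (simp add: algebra_simps cong_trans)
  qed simp
  have "[power_sum (p - 3) K = power_sum (p - 3) (K mod p)] (mod int p)" for K
    using step[of "K mod p" "K div p"] by simp
  from this[of M] this[of N] show ?thesis
    using assms by (metis cong_def cong_sym cong_trans)
qed

text \<open>The exponent is even, so i and p - i contribute equally, and the full sum is zero. The
  bound p + 1 instead of p comes from the exclusive upper bound.\<close>

lemma power_sum_reflect:
  "N \<le> p + 1 \<Longrightarrow> [power_sum (p - 3) (p + 1 - N) = - power_sum (p - 3) N] (mod int p)"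
proof (induction N)
  case 0
  have "[power_sum (p - 3) (1 + p) = power_sum (p - 3) 1] (mod int p)" by (rule power_sum_add_p)
  then show ?case using p_gt_3 power_sum_Suc[of "p - 3" 0] by (simp add: power_0_left)
next
  case (Suc N)
  have "even (p - 3)" using odd_p by simp
  have "[int (p - N) = - int N] (mod int p)" using Suc.prems by (simp add: of_nat_diff cong_iff_dvd_diff)
  then have "[int (p - N) ^ (p - 3) = (- int N) ^ (p - 3)] (mod int p)" by (rule cong_pow)
  then have "[int (p - N) ^ (p - 3) = int N ^ (p - 3)] (mod int p)"
    using \<open>even (p - 3)\<close> by simp
  moreover have "[power_sum (p - 3) (p + 1 - N) = - power_sum (p - 3) N] (mod int p)"
    using Suc by simp
  ultimately have "[power_sum (p - 3) (p + 1 - N) - int (p - N) ^ (p - 3)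
      = - power_sum (p - 3) N - int N ^ (p - 3)] (mod int p)"
    by (intro cong_diff)
  moreover have "power_sum (p - 3) (p + 1 - N) = power_sum (p - 3) (p - N) + int (p - N) ^ (p - 3)"
    using Suc.prems power_sum_Suc[of "p - 3" "p - N"] by (simp add: Suc_diff_le)
  ultimately show ?case by (simp add: power_sum_Suc)
qed

text \<open>Reflection carried over to residue classes by reducing \<open>N\<close> modulo p. It
  will pair 5/6 with 1/6 and 4/6 with 2/6.\<close>

lemma power_sum_complement:
  assumes "[M + N = 1] (mod p)"
  shows "[power_sum (p - 3) M = - power_sum (p - 3) N] (mod int p)"
proof -
  have "N mod p < p" using p_gt_3 by simp
  have "[int (M + N) = int 1] (mod int p)" using assms cong_int_iff by blast
  then have "int p dvd int M + int N - 1" by (simp add: cong_iff_dvd_diff)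
  moreover have "int p dvd int (N mod p) - int N"
    by (metis cong_iff_dvd_diff cong_int_iff cong_mod_left cong_refl)
  moreover have "int M - int (p + 1 - N mod p)
      = (int M + int N - 1) + (int (N mod p) - int N) - int p"
    using \<open>N mod p < p\<close> by (simp add: of_nat_diff)
  ultimately have "int p dvd int M - int (p + 1 - N mod p)"
    by (metis dvd_add dvd_diff dvd_refl)
  then have "[M = p + 1 - N mod p] (mod p)"
    by (metis cong_iff_dvd_diff cong_int_iff)
  then have "[power_sum (p - 3) M = power_sum (p - 3) (p + 1 - N mod p)] (mod int p)"
    by (rule power_sum_cong)
  also have "[power_sum (p - 3) (p + 1 - N mod p) = - power_sum (p - 3) (N mod p)] (mod int p)"
    using \<open>N mod p < p\<close> by (intro power_sum_reflect) simp
  also have "[- power_sum (p - 3) (N mod p) = - power_sum (p - 3) N] (mod int p)"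
    using power_sum_cong[of "N mod p" N] by (simp add: cong_minus_minus_iff)
  finally show ?thesis .
qed

text \<open>Here \<open>h\<close> stands for 1/2. Doubling sends N and N + 1/2 to 2N and 2N + 1, and
  the factor 4 arises because the exponent acts as -2.\<close>

lemma power_sum_duplication:
  assumes h: "[2 * h = 1] (mod p)"
  shows "[power_sum (p - 3) N + power_sum (p - 3) (N + h) = 4 * power_sum (p - 3) (2 * N)] (mod int p)"
proof (induction N)
  case 0
  \<comment> \<open>As h + h = 1, \<open>h\<close> is its own complement, so its power sum
    vanishes.\<close>
  have "[power_sum (p - 3) h = - power_sum (p - 3) h] (mod int p)"
    using h by (intro power_sum_complement) (simp add: mult_2)
  then have "[int 2 * power_sum (p - 3) h = int 2 * 0] (mod int p)"
    by (simp add: cong_iff_dvd_diff)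
  then have "[power_sum (p - 3) h = 0] (mod int p)"
    by (rule cong_cancel_small[rotated 2]) (use p_gt_3 in auto)
  then show ?case by simp
next
  case (Suc N)
  have 4: "[4 * 2 ^ (p - 3) = 1] (mod int p)"
    using square_mult_power[OF not_p_dvd_small[of 2]] p_gt_3 by simp
  have double: "[K ^ (p - 3) = 4 * (2 * K) ^ (p - 3)] (mod int p)" for K
    using cong_sym[OF cong_scalar_right[OF 4, of "K ^ (p - 3)"]] by (simp add: power_mult_distrib mult.assoc)
  have "[int (2 * h) = int 1] (mod int p)" using h cong_int_iff by blast
  then have "[2 * int (N + h) = 2 * int N + 1] (mod int p)"
    using cong_add[OF cong_refl, of "int (2 * h)" 1 "int p" "2 * int N"] by simp
  then have "[4 * (2 * int (N + h)) ^ (p - 3) = 4 * (2 * int N + 1) ^ (p - 3)] (mod int p)"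
    by (intro cong_mult cong_pow cong_refl)
  then have "[int (N + h) ^ (p - 3) = 4 * (2 * int N + 1) ^ (p - 3)] (mod int p)"
    using double cong_trans by blast
  from cong_add[OF cong_add[OF Suc.IH double[of "int N"]] this]
  show ?case by (simp add: power_sum_Suc algebra_simps)
qed

text \<open>Here \<open>s\<close> stands for 1/6. A combination of power sums and 36 times
  \<open>U_poly\<close> satisfy the same recurrence modulo p; since p is odd, the homogeneous
  recurrence has no nonzero solution of period 3p, so the two agree.\<close>

lemma U_cong_power_sum_sixths:
  assumes s: "[6 * s = 1] (mod p)"
  defines "G \<equiv> power_sum (p - 3)"
  shows "[36 * U (p - 3) = G (5 * s) + G (4 * s) - G (2 * s) - G s] (mod int p)"
proof -
  let ?n = "p - 3"
  \<comment> \<open>The signs come from x^7 - x = (x^2 - x + 1) (x^5 + x^4 - x^2 - x): the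
    recurrence leaves only the shifts by 7 and by 1, whose arguments of \<open>G\<close> differ by 6
    s = 1.\<close>
  define A where "A y = G (s * (y + 5)) + G (s * (y + 4)) - G (s * (y + 2)) - G (s * (y + 1))" for y
  define W where "W y = A y - 36 * U_poly ?n (int y)" for y
  have s': "[6 * int s = 1] (mod int p)"
    using s by (metis cong_int_iff of_nat_1 of_nat_mult of_nat_numeral)
  have "\<not> p dvd s"
  proof
    assume "p dvd s"
    then have "[0 = 1] (mod p)" using s cong_sym cong_trans by (metis cong_0_iff dvd_mult)
    then show False using p_gt_3 by (simp add: cong_def)
  qed
  \<comment> \<open>The power of \<open>s\<close> is 36 because its product with s^2 is 1 and 36 s^2
    = 1.\<close>
  have "[36 * (int s ^ 2 * int s ^ ?n) = 36 * 1] (mod int p)"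
    using square_mult_power[OF \<open>\<not> p dvd s\<close>] by (rule cong_scalar_left)
  moreover have "[(6 * int s) ^ 2 * int s ^ ?n = 1 ^ 2 * int s ^ ?n] (mod int p)"
    using s' by (intro cong_mult cong_pow cong_refl)
  ultimately have s36: "[int s ^ ?n = 36] (mod int p)"
    by (simp add: power_mult_distrib mult.assoc) (metis cong_sym cong_trans)
  have rec: "[W (y + 2) - W (y + 1) + W y = 0] (mod int p)" for y
  proof -
    have "[s * (y + 7) = Suc (s * (y + 1))] (mod p)"
      using cong_add[OF s cong_refl, of "s * (y + 1)"] by (simp add: algebra_simps)
    then have "[G (s * (y + 7)) = G (s * (y + 1)) + int (s * (y + 1)) ^ ?n] (mod int p)"
      unfolding G_def power_sum_Suc[symmetric] by (rule power_sum_cong)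
    moreover have "[int (s * (y + 1)) ^ ?n = 36 * int (y + 1) ^ ?n] (mod int p)"
      unfolding of_nat_mult power_mult_distrib by (rule cong_scalar_right[OF s36])
    ultimately have "[G (s * (y + 7)) = G (s * (y + 1)) + 36 * int (y + 1) ^ ?n] (mod int p)"
      using cong_add[OF cong_refl] cong_trans by blast
    then have "[G (s * (y + 7)) - (G (s * (y + 1)) + 36 * int (y + 1) ^ ?n) = 0] (mod int p)"
      by (simp add: cong_iff_dvd_diff)
    moreover have "W (y + 2) - W (y + 1) + W y
        = G (s * (y + 7)) - (G (s * (y + 1)) + 36 * int (y + 1) ^ ?n)"
    proof -
      have "A (y + 2) - A (y + 1) + A y = G (s * (y + 7)) - G (s * (y + 1))"
      proof -
        have shifts: "y + 2 + 5 = y + 7" "y + 2 + 4 = y + 6" "y + 2 + 2 = y + 4" "y + 2 + 1 = y + 3"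
          "y + 1 + 5 = y + 6" "y + 1 + 4 = y + 5" "y + 1 + 2 = y + 3" "y + 1 + 1 = y + 2"
          by simp_all
        show ?thesis unfolding A_def shifts by linarith
      qed
      moreover have "U_poly ?n (int (y + 2)) - U_poly ?n (int (y + 1)) + U_poly ?n (int y) = int (y + 1) ^ ?n"
        using U_poly_recurrence[of ?n "int (y + 1)"] by (simp add: algebra_simps)
      ultimately show ?thesis unfolding W_def by linarith
    qed
    ultimately show ?thesis by simp
  qed
  \<comment> \<open>\<open>W\<close> changes sign under a shift by 3, hence under the odd multiple \<open>3 p\<close>, which is also a period.\<close>
  have flip: "[W (y + 3) = - W y] (mod int p)" for y
    using cong_add[OF rec[of "y + 1"] rec[of y]] by (simp add: cong_iff_dvd_diff numeral_3_eq_3)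
  have "[W (3 * k) = (- 1) ^ k * W 0] (mod int p)" for k
  proof (induction k)
    case (Suc k)
    have "[W (3 * k + 3) = - W (3 * k)] (mod int p)" by (rule flip)
    also have "[- W (3 * k) = - ((- 1) ^ k * W 0)] (mod int p)"
      using Suc.IH by (simp add: cong_minus_minus_iff)
    finally show ?case by (simp add: algebra_simps)
  qed simp
  from this[of p] have "[W (3 * p) = - W 0] (mod int p)" using odd_p by simp
  moreover have "[W (3 * p) = W 0] (mod int p)"
  proof -
    have "[G (s * (3 * p + c)) = G (s * (0 + c))] (mod int p)" for c
    proof -
      have "s * (3 * p + c) = s * (0 + c) + 3 * s * p" by (simp add: algebra_simps)
      then have "[s * (3 * p + c) = s * (0 + c)] (mod p)" by (simp only: cong_def mod_mult_self1)
      then show ?thesis unfolding G_def by (rule power_sum_cong)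
    qed
    moreover have "[U_poly ?n (int (3 * p)) = U_poly ?n (int 0)] (mod int p)"
      by (intro U_poly_cong) (simp add: cong_def)
    ultimately show ?thesis
      unfolding W_def A_def by (intro cong_diff cong_add cong_mult cong_refl)
  qed
  ultimately have "[W 0 = - W 0] (mod int p)" using cong_sym cong_trans by blast
  then have "[int 2 * W 0 = int 2 * 0] (mod int p)"
    by (simp add: cong_iff_dvd_diff)
  then have "[W 0 = 0] (mod int p)"
    by (rule cong_cancel_small[rotated 2]) (use p_gt_3 in auto)
  then have "[A 0 - 36 * U ?n = 0] (mod int p)" by (simp add: W_def U_poly_0)
  then have "[A 0 = 36 * U ?n] (mod int p)" by (simp add: cong_iff_dvd_diff)
  moreover have "A 0 = G (5 * s) + G (4 * s) - G (2 * s) - G s"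
    by (simp only: A_def add_0 mult_1 mult_1_right mult.commute)
  ultimately show ?thesis by (simp add: cong_sym)
qed

text \<open>With s = 1/6, \<open>Suc r\<close> is 5/6. Let g = G(2/6). Duplication and complement
  give G(4/6) = -g, G(1/6) = 5g and G(5/6) = -5g, so 36 U = -12 g and G(5/6) = 15 U.\<close>

lemma power_sum_cong_U:
  assumes r: "r < p" "p dvd 6 * r + 1"
  shows "[power_sum (p - 3) (Suc r) = 15 * U (p - 3)] (mod int p)"
proof -
  define G where "G = power_sum (p - 3)"
  define s where "s = p - r"
  have "int p dvd 6 * int r + 1" using r(2) by (metis int_dvd_int_iff int_plus of_nat_1 of_nat_mult of_nat_numeral)
  moreover have "int (6 * s) - int 1 = 6 * int p - (6 * int r + 1)"
    using r(1) by (simp add: s_def of_nat_diff)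
  ultimately have "int p dvd int (6 * s) - int 1" by (metis dvd_diff dvd_triv_right)
  then have s: "[6 * s = 1] (mod p)" by (metis cong_iff_dvd_diff cong_int_iff)
  have 36: "[36 * U (p - 3) = G (5 * s) + G (4 * s) - G (2 * s) - G s] (mod int p)"
    unfolding G_def using U_cong_power_sum_sixths[OF s] .
  have 5: "[G (5 * s) = - G s] (mod int p)" and 4: "[G (4 * s) = - G (2 * s)] (mod int p)"
    unfolding G_def using s by (intro power_sum_complement; simp)+
  have "[G s + G (s + 3 * s) = 4 * G (2 * s)] (mod int p)"
    unfolding G_def using s by (intro power_sum_duplication) simp
  then have dup: "[G s + G (4 * s) = 4 * G (2 * s)] (mod int p)" by simp
  have "Suc r + s = 1 + p" using r(1) by (simp add: s_def)
  then have "[Suc r + s = 1] (mod p)" by (simp only: cong_def mod_add_self2)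
  then have refl: "[G (Suc r) = - G s] (mod int p)"
    unfolding G_def by (rule power_sum_complement)
  \<comment> \<open>The coefficients 5, 5, 3, 2, -12 eliminate \<open>G\<close> at all multiples of
    \<open>s\<close>, leaving 180 U - 12 G(Suc r).\<close>
  have "int p dvd 5 * (36 * U (p - 3) - (G (5 * s) + G (4 * s) - G (2 * s) - G s))
      + 5 * (G (5 * s) + G s) + 3 * (G (4 * s) + G (2 * s)) + 2 * (G s + G (4 * s) - 4 * G (2 * s))
      - 12 * (G (Suc r) + G s)"
    using 36 5 4 dup refl unfolding cong_iff_dvd_diff diff_minus_eq_add
    by (rule_tac dvd_diff[OF dvd_add[OF dvd_add[OF dvd_add]]]) (erule dvd_mult)+
  also have "\<dots> = int 3 * (int 4 * (15 * U (p - 3))) - int 3 * (int 4 * G (Suc r))"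
    by simp
  finally have "[int 3 * (int 4 * G (Suc r)) = int 3 * (int 4 * (15 * U (p - 3)))] (mod int p)"
    by (simp add: cong_iff_dvd_diff dvd_diff_commute)
  \<comment> \<open>The factor 12 may exceed p, so it is cancelled as 3 and then 4, both below
    p.\<close>
  then have "[int 4 * G (Suc r) = int 4 * (15 * U (p - 3))] (mod int p)"
    by (rule cong_cancel_small[rotated 2]) (use p_gt_3 in auto)
  moreover have "p \<noteq> 4" using odd_p by auto
  then have "4 < p" using p_gt_3 by simp
  ultimately show ?thesis
    unfolding G_def using cong_cancel_small[of 4] by simp
qed

end

section \<open>The truncated hypergeometric sum\<close>

text \<open>F(a,k) of the overview as a product, which shows it to be a polynomial in
  \<open>a\<close>.\<close>

definition hyp_term :: "rat \<Rightarrow> nat \<Rightarrow> rat" where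
  "hyp_term a k = (\<Prod>i<k. (a - of_nat i) * (- 1 - a - of_nat i) / of_nat (Suc i) ^ 2)"

text \<open>M(a) of the overview for n = p. The factor \<open>2 * a + 1\<close> makes the
  denominators \<open>2 * k + 1\<close> cancel in differences.\<close>

definition hyp_sum :: "nat \<Rightarrow> rat \<Rightarrow> rat" where
  "hyp_sum n a = (2 * a + 1) * (\<Sum>k<n. hyp_term a k / (2 * of_nat k + 1))"

text \<open>R(a) of the overview for n = p - 1; in general binom(n + a, n) binom(n - a, n).\<close>

definition sq_prod :: "nat \<Rightarrow> rat \<Rightarrow> rat" where
  "sq_prod n a = (\<Prod>i<n. 1 - (a / of_nat (Suc i)) ^ 2)"

text \<open>The product of the binomials is (6k)! / ((3k)! k! (2k)!), so the quotient of neighbours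
  is a rational function of k, here cleared of denominators.\<close>

lemma binomial_product_Suc:
  "12 * (6 * k + 1) * (6 * k + 5) * (((6 * k) choose (3 * k)) * ((3 * k) choose k))
    = (k + 1) ^ 2 * (((6 * Suc k) choose (3 * Suc k)) * ((3 * Suc k) choose Suc k))"
proof -
  define B where "B k = real (((6 * k) choose (3 * k)) * ((3 * k) choose k))" for k :: nat
  have B: "B k * (fact (3 * k) * fact k * fact (2 * k)) = fact (6 * k)" for k
    unfolding B_def by (simp add: binomial_fact)
  define f6 f3 f2 f1 :: real where "f6 = fact (6 * k)" and "f3 = fact (3 * k)"
    and "f2 = fact (2 * k)" and "f1 = fact k"
  define x where "x = real k"
  have 6: "fact (6 * Suc k) = (6 * x + 6) * (6 * x + 5) * (6 * x + 4) * (6 * x + 3) * (6 * x + 2) * (6 * x + 1) * f6"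
    by (simp add: f6_def x_def numeral_eq_Suc algebra_simps)
  have 3: "fact (3 * Suc k) = (3 * x + 3) * (3 * x + 2) * (3 * x + 1) * f3"
    by (simp add: f3_def x_def numeral_eq_Suc algebra_simps)
  have 2: "fact (2 * Suc k) = (2 * x + 2) * (2 * x + 1) * f2"
    by (simp add: f2_def x_def numeral_eq_Suc algebra_simps)
  have 1: "fact (Suc k) = (x + 1) * f1"
    by (simp add: f1_def x_def algebra_simps)
  have "((3 * x + 3) * (3 * x + 2) * (3 * x + 1) * f3) * ((x + 1) * f1) * ((2 * x + 2) * (2 * x + 1) * f2) * B (Suc k)
      = (6 * x + 6) * (6 * x + 5) * (6 * x + 4) * (6 * x + 3) * (6 * x + 2) * (6 * x + 1) * (B k * (f3 * f1 * f2))"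
    using B[of "Suc k"] B[of k] unfolding 6 3 2 1 f6_def[symmetric] f3_def[symmetric] f2_def[symmetric] f1_def[symmetric]
    by (simp add: mult_ac)
  moreover have "((3 * x + 3) * (3 * x + 2) * (3 * x + 1) * f3) * ((x + 1) * f1) * ((2 * x + 2) * (2 * x + 1) * f2) * B (Suc k)
      = (6 * (3 * x + 2) * (3 * x + 1) * (x + 1) * (2 * x + 1) * f3 * f1 * f2) * ((x + 1) ^ 2 * B (Suc k))"
  proof -
    have "3 * x + 3 = 3 * (x + 1)" "2 * x + 2 = 2 * (x + 1)" by simp_all
    then show ?thesis by (simp only: power2_eq_square mult_ac)
  qed
  moreover have "(6 * x + 6) * (6 * x + 5) * (6 * x + 4) * (6 * x + 3) * (6 * x + 2) * (6 * x + 1) * (B k * (f3 * f1 * f2))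
      = (6 * (3 * x + 2) * (3 * x + 1) * (x + 1) * (2 * x + 1) * f3 * f1 * f2) * (12 * (6 * x + 1) * (6 * x + 5) * B k)"
  proof -
    have "6 * x + 6 = 6 * (x + 1)" "6 * x + 4 = 2 * (3 * x + 2)" "6 * x + 3 = 3 * (2 * x + 1)" "6 * x + 2 = 2 * (3 * x + 1)"
      by simp_all
    then show ?thesis by (simp only: mult_ac)
  qed
  ultimately have "(6 * (3 * x + 2) * (3 * x + 1) * (x + 1) * (2 * x + 1) * f3 * f1 * f2) * ((x + 1) ^ 2 * B (Suc k))
     = (6 * (3 * x + 2) * (3 * x + 1) * (x + 1) * (2 * x + 1) * f3 * f1 * f2) * (12 * (6 * x + 1) * (6 * x + 5) * B k)"
    by simp
  moreover have "6 * (3 * x + 2) * (3 * x + 1) * (x + 1) * (2 * x + 1) * f3 * f1 * f2 \<noteq> 0"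
    unfolding x_def f3_def f2_def f1_def by (simp add: add_eq_0_iff_both_eq_0 add_pos_pos less_imp_neq[symmetric] add_nonneg_pos)
  ultimately have "(x + 1) ^ 2 * B (Suc k) = 12 * (6 * x + 1) * (6 * x + 5) * B k" by simp
  then have "real ((k + 1) ^ 2 * (((6 * Suc k) choose (3 * Suc k)) * ((3 * Suc k) choose Suc k)))
      = real (12 * (6 * k + 1) * (6 * k + 5) * (((6 * k) choose (3 * k)) * ((3 * k) choose k)))"
    unfolding B_def x_def by (simp add: algebra_simps)
  then show ?thesis by (simp only: of_nat_eq_iff)
qed

text \<open>At a = -1/6 the k-th factor is (6k+1)(6k+5) / (36 (k+1)^2), and 432 = 12 * 36 accounts
  for the 12 in \<open>binomial_product_Suc\<close>.\<close>

lemma hyp_term_minus_sixth: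
  "hyp_term (- 1 / 6) k = of_nat (((6 * k) choose (3 * k)) * ((3 * k) choose k)) / 432 ^ k"
proof (induction k)
  case 0
  then show ?case by (simp add: hyp_term_def)
next
  case (Suc k)
  define B where "B k = (of_nat (((6 * k) choose (3 * k)) * ((3 * k) choose k)) :: rat)" for k :: nat
  define x where "x = (of_nat k :: rat)"
  have "of_nat (12 * (6 * k + 1) * (6 * k + 5)) * B k = of_nat ((k + 1) ^ 2) * B (Suc k)"
    unfolding B_def of_nat_mult[symmetric] binomial_product_Suc[symmetric] by (simp only: mult.assoc)
  then have rec: "12 * (6 * x + 1) * (6 * x + 5) * B k = (x + 1) ^ 2 * B (Suc k)"
    by (simp add: x_def add.commute)
  have "x + 1 \<noteq> 0" unfolding x_def by (metis Suc_eq_plus1 of_nat_1 of_nat_add of_nat_neq_0)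
  have "hyp_term (- 1 / 6) (Suc k) = B k / 432 ^ k * ((- 1 / 6 - x) * (- 1 - (- 1 / 6) - x) / (x + 1) ^ 2)"
    using Suc.IH by (simp add: hyp_term_def B_def x_def add.commute)
  also have "\<dots> = (12 * (6 * x + 1) * (6 * x + 5) * B k) / (432 * 432 ^ k * (x + 1) ^ 2)"
    using \<open>x + 1 \<noteq> 0\<close> by (simp add: field_simps)
  also have "\<dots> = B (Suc k) / 432 ^ Suc k"
    unfolding rec using \<open>x + 1 \<noteq> 0\<close> by simp
  finally show ?case by (simp add: B_def)
qed

section \<open>The difference equation in a\<close>

lemma hyp_sum_trivial: "hyp_sum (Suc n) 0 = 1" "hyp_sum (Suc n) (- 1) = - 1"
proof -
  have ht: "hyp_term b k = of_bool (k = 0)" if "b = 0 \<or> b = - 1" for b k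
  proof (cases k)
    case (Suc j)
    then have "hyp_term b k = 0"
      unfolding hyp_term_def using that by (intro prod_zero bexI[of _ 0]) auto
    then show ?thesis using Suc by simp
  qed (simp add: hyp_term_def)
  have "(\<Sum>k<Suc n. hyp_term b k / (2 * of_nat k + 1)) = 1" if "b = 0 \<or> b = - 1" for b
  proof -
    have "(\<Sum>k<Suc n. hyp_term b k / (2 * of_nat k + 1)) = (\<Sum>k<Suc n. if k = 0 then 1 else 0)"
      by (intro sum.cong) (auto simp: ht[OF that])
    then show ?thesis by simp
  qed
  then show "hyp_sum (Suc n) 0 = 1" "hyp_sum (Suc n) (- 1) = - 1" by (simp_all add: hyp_sum_def del: sum.lessThan_Suc)
qed

text \<open>Multiplied by a, the two k-th terms share a factor q(k), and (2a+1)(a+k) - (2a-1)(a-k) =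
  2a(2k+1) cancels the denominator. As a is divided out, a = 0 is treated separately by the values
  at 0 and -1.\<close>

lemma hyp_sum_diff: "hyp_sum (Suc n) a - hyp_sum (Suc n) (a - 1) = 2 * sq_prod n a"
proof (cases "a = 0")
  case True
  then show ?thesis using hyp_sum_trivial[of n] by (simp add: sq_prod_def)
next
  case False
  define q where "q k = (\<Prod>i<k. (of_nat i ^ 2 - a ^ 2) / of_nat (Suc i) ^ 2)" for k
  have q_Suc: "q (Suc k) = q k * ((of_nat k ^ 2 - a ^ 2) / of_nat (Suc k) ^ 2)" for k
    by (simp add: q_def)
  have F: "a * hyp_term a k = (a + of_nat k) * q k" for k
  proof (induction k)
    case (Suc k)
    have "a * hyp_term a (Suc k)
        = a * hyp_term a k * ((a - of_nat k) * (- 1 - a - of_nat k) / of_nat (Suc k) ^ 2)"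
      by (simp add: hyp_term_def)
    also have "\<dots> = (a + of_nat k) * q k * ((a - of_nat k) * (- 1 - a - of_nat k) / of_nat (Suc k) ^ 2)"
      unfolding Suc.IH ..
    also have "\<dots> = (a + of_nat (Suc k)) * q (Suc k)"
    proof -
      have "(a + of_nat k) * ((a - of_nat k) * (- 1 - a - of_nat k))
          = (a + of_nat (Suc k)) * (of_nat k ^ 2 - a ^ 2)"
        by (simp add: power2_eq_square algebra_simps)
      then have "q k * ((a + of_nat k) * ((a - of_nat k) * (- 1 - a - of_nat k))) / of_nat (Suc k) ^ 2
          = q k * ((a + of_nat (Suc k)) * (of_nat k ^ 2 - a ^ 2)) / of_nat (Suc k) ^ 2"
        by (simp only:)
      then show ?thesis by (simp only: q_Suc times_divide_eq_right times_divide_eq_left mult_ac)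
    qed
    finally show ?case .
  qed (simp add: hyp_term_def q_def)
  have F': "a * hyp_term (a - 1) k = (a - of_nat k) * q k" for k
  proof (induction k)
    case (Suc k)
    have "a * hyp_term (a - 1) (Suc k)
        = a * hyp_term (a - 1) k * ((a - 1 - of_nat k) * (- 1 - (a - 1) - of_nat k) / of_nat (Suc k) ^ 2)"
      by (simp add: hyp_term_def)
    also have "\<dots> = (a - of_nat k) * q k * ((a - 1 - of_nat k) * (- 1 - (a - 1) - of_nat k) / of_nat (Suc k) ^ 2)"
      unfolding Suc.IH ..
    also have "\<dots> = (a - of_nat (Suc k)) * q (Suc k)"
    proof -
      have "(a - of_nat k) * ((a - 1 - of_nat k) * (- 1 - (a - 1) - of_nat k))
          = (a - of_nat (Suc k)) * (of_nat k ^ 2 - a ^ 2)"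
        by (simp add: power2_eq_square algebra_simps)
      then have "q k * ((a - of_nat k) * ((a - 1 - of_nat k) * (- 1 - (a - 1) - of_nat k))) / of_nat (Suc k) ^ 2
          = q k * ((a - of_nat (Suc k)) * (of_nat k ^ 2 - a ^ 2)) / of_nat (Suc k) ^ 2"
        by (simp only:)
      then show ?thesis by (simp only: q_Suc times_divide_eq_right times_divide_eq_left mult_ac)
    qed
    finally show ?case .
  qed (simp add: hyp_term_def q_def)
  have summand: "((2 * a + 1) * hyp_term a k - (2 * a - 1) * hyp_term (a - 1) k) / (2 * of_nat k + 1) = 2 * q k" for k
  proof -
    have "a * ((2 * a + 1) * hyp_term a k - (2 * a - 1) * hyp_term (a - 1) k)
        = (2 * a + 1) * (a * hyp_term a k) - (2 * a - 1) * (a * hyp_term (a - 1) k)"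
      by (simp add: algebra_simps)
    also have "\<dots> = a * (2 * q k * (2 * of_nat k + 1))"
      unfolding F F' by (simp add: algebra_simps)
    finally have "(2 * a + 1) * hyp_term a k - (2 * a - 1) * hyp_term (a - 1) k = 2 * q k * (2 * of_nat k + 1)"
      using False mult_left_cancel by blast
    moreover have "(2 * of_nat k + 1 :: rat) \<noteq> 0"
      by (metis Suc_eq_plus1 of_nat_1 of_nat_add of_nat_mult of_nat_neq_0 of_nat_numeral)
    ultimately show ?thesis by simp
  qed
  \<comment> \<open>The right-hand side is \<open>sq_prod (Suc k) a - sq_prod k a\<close>, so the
    sum of the q(k) telescopes.\<close>
  have q_sq: "q (Suc k) = - ((a / of_nat (Suc k)) ^ 2) * sq_prod k a" for k
  proof (induction k)
    case (Suc k)
    have nz: "(of_nat (Suc k) :: rat) \<noteq> 0" by (rule of_nat_neq_0)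
    have "q (Suc (Suc k)) = - ((a / of_nat (Suc k)) ^ 2) * sq_prod k a
        * ((of_nat (Suc k) ^ 2 - a ^ 2) / of_nat (Suc (Suc k)) ^ 2)"
      unfolding q_Suc[of "Suc k"] Suc.IH ..
    also have "\<dots> = - ((a / of_nat (Suc (Suc k))) ^ 2) * (sq_prod k a * (1 - (a / of_nat (Suc k)) ^ 2))"
      using nz by (simp add: power_divide divide_simps del: of_nat_Suc)
    also have "sq_prod k a * (1 - (a / of_nat (Suc k)) ^ 2) = sq_prod (Suc k) a"
      by (simp add: sq_prod_def)
    finally show ?case .
  qed (simp add: q_def sq_prod_def)
  have q_sum: "(\<Sum>k<Suc n. q k) = sq_prod n a"
  proof (induction n)
    case (Suc n)
    have "(\<Sum>k<Suc (Suc n). q k) = sq_prod n a * (1 - (a / of_nat (Suc n)) ^ 2)"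
      using Suc.IH q_sq[of n] by (simp add: algebra_simps del: of_nat_Suc)
    then show ?case by (simp add: sq_prod_def)
  qed (simp add: q_def sq_prod_def)
  have "hyp_sum (Suc n) a - hyp_sum (Suc n) (a - 1)
      = (\<Sum>k<Suc n. ((2 * a + 1) * hyp_term a k - (2 * a - 1) * hyp_term (a - 1) k) / (2 * of_nat k + 1))"
    unfolding hyp_sum_def sum_distrib_left sum_subtractf[symmetric]
    by (intro sum.cong) (simp_all add: diff_divide_distrib)
  then show ?thesis unfolding summand using q_sum by (simp add: sum_distrib_left[symmetric])
qed

lemma hyp_sum_add:
  "hyp_sum (Suc n) (b + of_nat k) = hyp_sum (Suc n) b + (\<Sum>c = 1..k. 2 * sq_prod n (b + of_nat c))"
proof (induction k)
  case (Suc k)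
  then show ?case using hyp_sum_diff[of n "b + of_nat (Suc k)"] by (simp add: algebra_simps)
qed simp

text \<open>The numerator consists of the chains i - b and i + b; passing from b - 1 to b moves each
  by one, so only end factors change. Clearing denominators keeps it valid where these
  vanish.\<close>

lemma sq_prod_shift:
  "b * (of_nat n + 1 - b) * sq_prod n b = (1 - b) * (of_nat n + b) * sq_prod n (b - 1)"
proof (induction n)
  case 0
  then show ?case by (simp add: sq_prod_def)
next
  case (Suc n)
  define N where "N = (of_nat (Suc n) :: rat)"
  have N: "N \<noteq> 0" "of_nat n = N - 1" unfolding N_def by (rule of_nat_neq_0) simp
  have step: "sq_prod (Suc n) c = sq_prod n c * ((N - c) * (N + c) / N ^ 2)" for c
    using N(1) by (simp add: sq_prod_def N_def[symmetric] field_simps power2_eq_square del: of_nat_Suc)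
  have e: "N + 1 - b = N - (b - 1)" "N - 1 + b = N + (b - 1)" by simp_all
  have "b * (N + 1 - b) * sq_prod (Suc n) b
      = (N + 1 - b) * (N + b) / N ^ 2 * (b * (of_nat n + 1 - b) * sq_prod n b)"
    by (simp add: step N(2))
  also have "\<dots> = (N + 1 - b) * (N + b) / N ^ 2 * ((1 - b) * (N - 1 + b) * sq_prod n (b - 1))"
    unfolding Suc.IH using N(2) by simp
  also have "\<dots> = (1 - b) * (N + b) * sq_prod (Suc n) (b - 1)"
    unfolding step e by (simp only: times_divide_eq_right times_divide_eq_left mult_ac)
  finally show ?case by (simp add: N_def)
qed

section \<open>Congruences modulo the cube of p\<close>

context
  fixes p :: nat
  assumes prime: "prime p" and p_gt_3: "p > 3"
begin

lemmas [simp] = p_integral_of_int[OF prime] p_integral_of_nat[OF prime] p_integral_0[OF prime]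
  p_integral_1[OF prime] p_integral_numeral[OF prime] p_integral_mult[OF prime] p_integral_add[OF prime]
  p_integral_minus[OF prime] p_integral_diff[OF prime] p_integral_power[OF prime] pcong_refl[OF prime]

lemma p_integral_inverse_shift:
  assumes "\<not> p dvd c" and z: "p_integral p z"
  shows "of_nat c + of_nat p * z \<noteq> 0" and "p_integral p (1 / (of_nat c + of_nat p * z))"
proof -
  obtain u v where v: "coprime v (int p)" and uv: "z = of_int u / of_int v"
    using z unfolding p_integral_iff[OF prime] by blast
  have "v \<noteq> 0" using v prime by (auto simp: prime_nat_iff)
  define d where "d = int c * v + int p * u"
  have eq: "of_nat c + of_nat p * z = of_int d / of_int v"
    using \<open>v \<noteq> 0\<close> by (simp add: uv d_def field_simps)
  have "coprime (int c) (int p)"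
    using prime_imp_coprime[OF prime assms(1)] by (simp add: coprime_commute)
  then have "coprime (int c * v) (int p)" using v by simp
  then have d: "coprime d (int p)"
    unfolding d_def using gcd_add_mult[of "int p" u "int c * v"]
    by (simp add: coprime_iff_gcd_eq_1 gcd.commute add.commute mult.commute)
  then have "d \<noteq> 0" using prime by (auto simp: prime_nat_iff)
  then show "of_nat c + of_nat p * z \<noteq> 0" using \<open>v \<noteq> 0\<close> by (simp add: eq)
  have "1 / (of_nat c + of_nat p * z) = of_int v / of_int d" by (simp add: eq)
  then show "p_integral p (1 / (of_nat c + of_nat p * z))"
    using d unfolding p_integral_iff[OF prime] by blast
qed

text \<open>Fermat's congruence divided by c^2, stated as an equation so that it can be inserted
  into exact expansions.\<close>

lemma inverse_square_cong:
  assumes "\<not> p dvd c"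
  shows "\<exists>w. p_integral p w \<and> 1 / of_nat c ^ 2 = of_int (int c ^ (p - 3)) + of_nat p * w"
proof -
  have "pcong p 1 (of_int (int c ^ 2 * int c ^ (p - 3))) (of_int 1)"
    by (rule pcong_1_of_int[OF prime square_mult_power[OF prime p_gt_3 assms]])
  then obtain z where z: "p_integral p z"
    "of_int (int c ^ 2 * int c ^ (p - 3)) = 1 + of_nat p * z"
    unfolding pcong_def[OF prime] by auto
  have c: "(of_nat c :: rat) \<noteq> 0" using assms by (metis dvd_0_right of_nat_eq_0_iff)
  have "(of_nat c :: rat) ^ 2 * of_int (int c ^ (p - 3)) = 1 + of_nat p * z"
    using z(2) by simp
  then have "1 / of_nat c ^ 2 = of_int (int c ^ (p - 3)) + of_nat p * (- z * (1 / of_nat c) ^ 2)"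
    using c by (simp add: field_simps)
  moreover have "p_integral p (- z * (1 / of_nat c) ^ 2)"
    using z(1) p_integral_inverse[OF prime assms] by simp
  ultimately show ?thesis by blast
qed

text \<open>Each factor is 1 - p^2 t^2 / i^2. Products of two corrections carry p^4, so modulo p^3
  only their sum remains, with 1 / i^2 needed only modulo p.\<close>

lemma sq_prod_multiple_p_partial:
  assumes t: "p_integral p t"
  shows "n < p \<Longrightarrow> pcong p 3 (sq_prod n (of_nat p * t))
    (1 - of_nat p ^ 2 * t ^ 2 * of_int (power_sum (p - 3) (Suc n)))"
proof (induction n)
  case 0
  then show ?case using p_gt_3 by (simp add: sq_prod_def power_sum_def power_0_left)
next
  case (Suc n)
  define S where "S = (of_int (power_sum (p - 3) (Suc n)) :: rat)"
  define s where "s = (of_int (int (Suc n) ^ (p - 3)) :: rat)"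
  have Ss: "p_integral p S" "p_integral p s" by (simp_all add: S_def s_def del: of_int_power of_nat_Suc)
  obtain z where z: "p_integral p z" "sq_prod n (of_nat p * t) = 1 - of_nat p ^ 2 * t ^ 2 * S + of_nat p ^ 3 * z"
    using Suc.IH Suc.prems unfolding pcong_def[OF prime] S_def by auto
  have "\<not> p dvd Suc n" using not_p_dvd_small[OF prime p_gt_3] Suc.prems by simp
  then obtain w where w: "p_integral p w" "1 / of_nat (Suc n) ^ 2 = s + of_nat p * w"
    using inverse_square_cong unfolding s_def by blast
  have "sq_prod (Suc n) (of_nat p * t)
      = sq_prod n (of_nat p * t) * (1 - of_nat p ^ 2 * t ^ 2 * (1 / of_nat (Suc n) ^ 2))"
    by (simp add: sq_prod_def power_divide power_mult_distrib del: of_nat_Suc)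
  also have "\<dots> = 1 - of_nat p ^ 2 * t ^ 2 * (S + s) + of_nat p ^ 3 *
      (of_nat p * t ^ 4 * S * (s + of_nat p * w) - t ^ 2 * w
        + z * (1 - of_nat p ^ 2 * t ^ 2 * (s + of_nat p * w)))"
    unfolding z(2) w(2) by (simp add: algebra_simps power_numeral_reduce)
  finally show ?case
    unfolding pcong_def[OF prime] using z(1) w(1) Ss t
    by (intro exI[of _ "of_nat p * t ^ 4 * S * (s + of_nat p * w) - t ^ 2 * w
        + z * (1 - of_nat p ^ 2 * t ^ 2 * (s + of_nat p * w))"])
      (simp add: S_def s_def power_sum_Suc[of _ "Suc n"])
qed

lemma sq_prod_multiple_p:
  assumes t: "p_integral p t"
  shows "pcong p 3 (sq_prod (p - 1) (of_nat p * t)) 1"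
proof -
  have "Suc (p - 1) = p" using p_gt_3 by simp
  then have 1: "pcong p 3 (sq_prod (p - 1) (of_nat p * t))
      (1 - of_nat p ^ 2 * t ^ 2 * of_int (power_sum (p - 3) p))"
    using sq_prod_multiple_p_partial[OF t, of "p - 1"] p_gt_3 by simp
  obtain c where c: "power_sum (p - 3) p = int p * c"
    using power_sum_full[OF prime p_gt_3] by (auto simp: cong_0_iff elim: dvdE)
  have "pcong p 3 (1 - of_nat p ^ 2 * t ^ 2 * of_int (power_sum (p - 3) p)) 1"
    unfolding pcong_def[OF prime] c using t
    by (intro exI[of _ "- (t ^ 2 * of_int c)"]) (simp add: power_numeral_reduce mult_ac)
  with 1 show ?thesis by (rule pcong_trans[OF prime])
qed

text \<open>The left-hand factors vanish modulo \<open>p\<close> only for \<open>c = 0\<close>; carrying them along makes the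
  quantity \<open>Y\<close> invariant modulo \<open>p\<close> under the recurrence \<open>sq_prod_shift\<close>.\<close>
lemma sq_prod_residue_class:
  assumes t: "p_integral p t"
  shows "c < p \<Longrightarrow> \<exists>Y w. p_integral p Y \<and> p_integral p w \<and> Y = t * (t + 1) + of_nat p * w \<and>
    (of_nat c + of_nat p * t) * (of_nat c + of_nat p * (t + 1)) * sq_prod (p - 1) (of_nat c + of_nat p * t)
      = of_nat p ^ 2 * Y"
proof (induction c)
  case 0
  obtain z where z: "p_integral p z" "sq_prod (p - 1) (of_nat p * t) = 1 + of_nat p ^ 3 * z"
    using sq_prod_multiple_p[OF t] unfolding pcong_def[OF prime] by auto
  show ?case
    by (rule exI[of _ "t * (t + 1) * (1 + of_nat p ^ 3 * z)"],
        rule exI[of _ "t * (t + 1) * (of_nat p ^ 2 * z)"])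
      (use z t in \<open>simp add: algebra_simps power_numeral_reduce\<close>)
next
  case (Suc c)
  then obtain Y w where Y: "p_integral p Y" "p_integral p w" "Y = t * (t + 1) + of_nat p * w"
    and eq: "(of_nat c + of_nat p * t) * (of_nat c + of_nat p * (t + 1)) * sq_prod (p - 1) (of_nat c + of_nat p * t)
      = of_nat p ^ 2 * Y"
    by auto
  define b where "b = of_nat (Suc c) + of_nat p * t"
  define P where "P = (of_nat p :: rat)"
  define R where "R = sq_prod (p - 1) b"
  define v where "v = 1 / (b - P)"
  have ndvd: "\<not> p dvd Suc c" using not_p_dvd_small[OF prime p_gt_3] Suc.prems by simp
  have bP: "b - P = of_nat (Suc c) + of_nat p * (t - 1)" by (simp add: b_def P_def algebra_simps)
  have v: "b - P \<noteq> 0" "p_integral p v"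
    unfolding v_def bP using p_integral_inverse_shift[OF ndvd, of "t - 1"] t by auto
  have pm: "of_nat (p - 1) = P - 1" using p_gt_3 by (simp add: P_def of_nat_diff)
  have "b * (b - P) * R = - (b * (of_nat (p - 1) + 1 - b) * R)"
    unfolding pm by (simp add: algebra_simps)
  also have "\<dots> = - ((1 - b) * (of_nat (p - 1) + b) * sq_prod (p - 1) (b - 1))"
    unfolding R_def sq_prod_shift ..
  also have "\<dots> = (b - 1) * (b - 1 + P) * sq_prod (p - 1) (b - 1)"
    unfolding pm by (simp add: algebra_simps)
  also have "\<dots> = P ^ 2 * Y"
  proof -
    have "b - 1 = of_nat c + P * t" "b - 1 + P = of_nat c + P * (t + 1)"
      by (simp_all add: b_def P_def algebra_simps)
    from eq[folded P_def, folded this] show ?thesis .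
  qed
  finally have rec: "b * (b - P) * R = P ^ 2 * Y" .
  \<comment> \<open>Replacing b - P by b + P multiplies by a number congruent to 1 modulo p, so
    \<open>Y\<close> changes only by a multiple of p.\<close>
  have bPv: "(b + P) * v = 1 + P * (2 * v)" using v(1) by (simp add: v_def field_simps)
  have "b * (b + P) * R = (b + P) * v * (b * (b - P) * R)" using v(1) by (simp add: v_def)
  also have "\<dots> = P ^ 2 * (Y + P * (2 * v * Y))" unfolding rec bPv by (simp add: algebra_simps)
  finally have "b * (b + P) * R = P ^ 2 * (Y + P * (2 * v * Y))" .
  moreover have "of_nat (Suc c) + P * t = b" "of_nat (Suc c) + P * (t + 1) = b + P"
    by (simp_all add: b_def P_def algebra_simps)
  moreover have "p_integral p (Y + P * (2 * v * Y))" "p_integral p (w + 2 * v * Y)"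
    using Y(1,2) v(2) by (simp_all add: P_def)
  moreover have "Y + P * (2 * v * Y) = t * (t + 1) + P * (w + 2 * v * Y)"
    using Y(3) by (simp add: P_def algebra_simps)
  ultimately show ?case unfolding P_def[symmetric] R_def by metis
qed

text \<open>For 0 < c < p both left factors in \<open>sq_prod_residue_class\<close> are units
  congruent to c, so they can be divided out, giving 1 / c^2.\<close>

lemma sq_prod_cong:
  assumes t: "p_integral p t" and c: "0 < c" "c < p"
  shows "pcong p 3 (sq_prod (p - 1) (of_nat p * t + of_nat c))
    (of_nat p ^ 2 * (t * (t + 1) * of_int (int c ^ (p - 3))))"
proof -
  define P where "P = (of_nat p :: rat)"
  define b where "b = of_nat c + P * t"
  define R where "R = sq_prod (p - 1) b"
  obtain Y w where Y: "p_integral p Y" "p_integral p w" "Y = t * (t + 1) + P * w"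
    and eq: "b * (of_nat c + P * (t + 1)) * R = P ^ 2 * Y"
    using sq_prod_residue_class[OF t c(2)] unfolding b_def P_def R_def by blast
  have ndvd: "\<not> p dvd c" using not_p_dvd_small[OF prime p_gt_3 c] .
  define u where "u = 1 / (of_nat c + P * t)"
  define v where "v = 1 / (of_nat c + P * (t + 1))"
  have nz: "of_nat c + P * t \<noteq> 0" "of_nat c + P * (t + 1) \<noteq> 0" and uv: "p_integral p u" "p_integral p v"
    unfolding u_def v_def P_def using p_integral_inverse_shift[OF ndvd] t by auto
  define X where "X = u * v * Y"
  have X: "p_integral p X" using uv Y(1) by (simp add: X_def)
  have "R = u * v * (b * (of_nat c + P * (t + 1)) * R)"
    using nz by (simp add: u_def v_def b_def)
  then have RX: "R = P ^ 2 * X" unfolding eq X_def by simp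
  have "Y = (of_nat c + P * t) * (of_nat c + P * (t + 1)) * X"
    using nz by (simp add: X_def u_def v_def)
  then have "of_nat c ^ 2 * X = t * (t + 1) + P * (w - (of_nat c * (2 * t + 1) + P * t * (t + 1)) * X)"
    using Y(3) by (simp add: algebra_simps power2_eq_square)
  then have cX: "pcong p 1 (of_nat c ^ 2 * X) (t * (t + 1))"
    unfolding pcong_def[OF prime] P_def using t X Y(2)
    by (intro exI[of _ "w - (of_nat c * (2 * t + 1) + of_nat p * t * (t + 1)) * X"]) simp
  obtain z where z: "p_integral p z" "1 / of_nat c ^ 2 = of_int (int c ^ (p - 3)) + of_nat p * z"
    using inverse_square_cong[OF ndvd] by blast
  have inv: "p_integral p (1 / of_nat c ^ 2)" unfolding z(2) using z(1) by simp
  have "X = 1 / of_nat c ^ 2 * (of_nat c ^ 2 * X)" using c by simp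
  then have "pcong p 1 X (1 / of_nat c ^ 2 * (t * (t + 1)))"
    using pcong_mult_left[OF prime inv cX] by simp
  moreover have "pcong p 1 (1 / of_nat c ^ 2 * (t * (t + 1))) (t * (t + 1) * of_int (int c ^ (p - 3)))"
    unfolding pcong_def[OF prime] z(2) using z(1) t
    by (intro exI[of _ "z * (t * (t + 1))"]) (simp add: algebra_simps)
  ultimately have "pcong p 1 X (t * (t + 1) * of_int (int c ^ (p - 3)))"
    by (rule pcong_trans[OF prime])
  from pcong_power_mult[OF prime this, of 2] show ?thesis
    by (simp add: RX[symmetric] P_def[symmetric] R_def b_def add.commute numeral_3_eq_3)
qed

section \<open>Polynomial dependence on a and values near multiples of p\<close>

lemma p_integral_poly:
  assumes "\<And>i. p_integral p (coeff Q i)" "p_integral p x"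
  shows "p_integral p (poly Q x)"
  unfolding poly_altdef using assms by (intro p_integral_sum[OF prime]) simp

lemma p_integral_coeff_mult:
  assumes "\<And>i. p_integral p (coeff Q i)" "\<And>i. p_integral p (coeff R i)"
  shows "p_integral p (coeff (Q * R) i)"
  unfolding coeff_mult using assms by (intro p_integral_sum[OF prime]) simp

lemma p_integral_coeff_pCons:
  assumes "p_integral p c" "\<And>i. p_integral p (coeff Q i)"
  shows "p_integral p (coeff (pCons c Q) i)"
  using assms by (simp add: coeff_pCons split: nat.split)

text \<open>Only squares of the numbers 1 to k, all prime to p, occur in the denominators.\<close>

lemma hyp_term_poly:
  "k < p \<Longrightarrow> \<exists>Q. (\<forall>i. p_integral p (coeff Q i)) \<and> (\<forall>a. poly Q a = hyp_term a k)"
proof (induction k)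
  case 0
  have "p_integral p (coeff 1 i)" for i by (simp add: coeff_1)
  then show ?case by (intro exI[of _ 1]) (simp add: hyp_term_def)
next
  case (Suc k)
  then obtain Q where Q: "\<And>i. p_integral p (coeff Q i)" "\<And>a. poly Q a = hyp_term a k" by auto
  define d where "d = (1 / of_nat (Suc k) :: rat)"
  have "\<not> p dvd Suc k" using not_p_dvd_small[OF prime p_gt_3] Suc.prems by simp
  then have d: "p_integral p d" unfolding d_def by (rule p_integral_inverse[OF prime])
  define R where "R = Q * ([:- of_nat k * d ^ 2, d ^ 2:] * [:- 1 - of_nat k, - 1:])"
  have "p_integral p (coeff R i)" for i
    unfolding R_def by (intro p_integral_coeff_mult p_integral_coeff_pCons Q(1)) (simp_all add: d)
  moreover have "poly R a = hyp_term a (Suc k)" for a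
  proof -
    have "hyp_term a (Suc k) = hyp_term a k * ((a - of_nat k) * (- 1 - a - of_nat k) * d ^ 2)"
      by (simp add: hyp_term_def d_def power_one_over)
    then show ?thesis by (simp add: R_def Q(2) algebra_simps)
  qed
  ultimately show ?case by blast
qed

text \<open>The term with \<open>2 k + 1 = p\<close> has a denominator \<open>p\<close>, so the expansion is made for \<open>p\<close> times the sum.\<close>
lemma hyp_sum_expansion:
  "\<exists>c1 c2 c3. p_integral p c1 \<and> p_integral p c2 \<and> p_integral p c3 \<and>
    (\<forall>t. p_integral p t \<longrightarrow> pcong p 3 (hyp_sum p (of_nat p * t)) (1 + c1 * t + c2 * t ^ 2 + c3 * t ^ 3))"
proof -
  have "\<exists>Q. (\<forall>i. p_integral p (coeff Q i)) \<and> (\<forall>a. poly Q a = of_nat p * hyp_term a k / (2 * of_nat k + 1))"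
    if k: "k < p" for k
  proof -
    have "p_integral p (of_nat p / of_nat (2 * k + 1))"
    proof (cases "p dvd 2 * k + 1")
      case True
      \<comment> \<open>Since 2k + 1 < 2p, the only possible multiple of p is p itself.\<close>
      then obtain m where m: "2 * k + 1 = p * m" by (elim dvdE)
      with k have "p * m < p * 2" by linarith
      then have "m = 1 \<or> m = 0" by auto
      then have "2 * k + 1 = p" using m by auto
      then show ?thesis using p_gt_3 by simp
    next
      case False
      then show ?thesis using p_integral_mult[OF prime, of "of_nat p" "1 / of_nat (2 * k + 1)"]
          p_integral_inverse[OF prime False] by simp
    qed
    then have coef: "p_integral p (of_nat p / (2 * of_nat k + 1))" by (simp add: add.commute)
    obtain Q where Q: "\<And>i. p_integral p (coeff Q i)" "\<And>a. poly Q a = hyp_term a k"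
      using hyp_term_poly[OF k] by auto
    have "p_integral p (coeff (smult (of_nat p / (2 * of_nat k + 1)) Q) i)"
      "poly (smult (of_nat p / (2 * of_nat k + 1)) Q) a = of_nat p * hyp_term a k / (2 * of_nat k + 1)" for i a
      unfolding coeff_smult by (rule p_integral_mult[OF prime coef Q(1)]) (simp add: Q(2))
    then show ?thesis by blast
  qed
  then obtain Q where Q: "\<And>k i. k < p \<Longrightarrow> p_integral p (coeff (Q k) i)"
    "\<And>k a. k < p \<Longrightarrow> poly (Q k) a = of_nat p * hyp_term a k / (2 * of_nat k + 1)"
    by metis
  define M where "M = [:1, 2:] * (\<Sum>k<p. Q k)"
  have M_int: "p_integral p (coeff M i)" for i
    unfolding M_def
    by (intro p_integral_coeff_mult p_integral_coeff_pCons)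
      (auto simp: coeff_sum intro!: p_integral_sum[OF prime] Q(1))
  have M: "poly M a = of_nat p * hyp_sum p a" for a
  proof -
    have "poly M a = (2 * a + 1) * (\<Sum>k<p. of_nat p * (hyp_term a k / (2 * of_nat k + 1)))"
      by (simp add: M_def poly_sum Q(2) algebra_simps)
    then show ?thesis unfolding hyp_sum_def sum_distrib_left[symmetric] by simp
  qed
  \<comment> \<open>At pt the coefficient of t^i gains p^i and dividing by p leaves p^(i-1), so the
    terms from i = 4 on vanish modulo p^3. The division is exact for i = 0 because c0 = p.\<close>
  obtain c0 M1 where M0: "M = pCons c0 M1" by (cases M)
  obtain c1 M2 where M1: "M1 = pCons c1 M2" by (cases M1)
  obtain c2 M3 where M2: "M2 = pCons c2 M3" by (cases M2)
  obtain c3 M4 where M3: "M3 = pCons c3 M4" by (cases M3)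
  have c: "p_integral p c1" "p_integral p c2" "p_integral p c3"
    using M_int[of 1] M_int[of 2] M_int[of 3]
    by (simp_all add: M0 M1 M2 M3 numeral_2_eq_2 numeral_3_eq_3)
  have M4: "p_integral p (coeff M4 i)" for i
    using M_int[of "Suc (Suc (Suc (Suc i)))"] by (simp add: M0 M1 M2 M3)
  have p0: "(of_nat p :: rat) \<noteq> 0" using p_gt_3 by simp
  have "hyp_sum p 0 = 1" using hyp_sum_trivial(1)[of "p - 1"] p_gt_3 by simp
  then have c0: "c0 = of_nat p" using M[of 0] by (simp add: M0)
  show ?thesis
  proof (intro exI conjI allI impI)
    fix t assume t: "p_integral p t"
    define P where "P = (of_nat p :: rat)"
    have "P * hyp_sum p (P * t)
        = P * (1 + c1 * t + (P * c2) * t ^ 2 + (P ^ 2 * c3) * t ^ 3 + P ^ 3 * (t ^ 4 * poly M4 (P * t)))"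
      unfolding P_def M[symmetric] by (simp add: M0 M1 M2 M3 c0 algebra_simps power_numeral_reduce)
    then have "hyp_sum p (P * t)
        = 1 + c1 * t + (P * c2) * t ^ 2 + (P ^ 2 * c3) * t ^ 3 + P ^ 3 * (t ^ 4 * poly M4 (P * t))"
      using p0 P_def mult_left_cancel by blast
    moreover have "p_integral p (t ^ 4 * poly M4 (P * t))"
      using t p_integral_poly[OF M4, of "P * t"] by (simp add: P_def)
    ultimately show "pcong p 3 (hyp_sum p (of_nat p * t))
        (1 + c1 * t + (of_nat p * c2) * t ^ 2 + (of_nat p ^ 2 * c3) * t ^ 3)"
      unfolding pcong_def[OF prime] P_def by blast
  qed (use c in simp_all)
qed

lemma sum_sq_prod_cong:
  assumes t: "p_integral p t" and r: "r < p"
  shows "pcong p 3 (\<Sum>c = 1..r. 2 * sq_prod (p - 1) (of_nat p * t + of_nat c))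
    (2 * of_nat p ^ 2 * (t * (t + 1)) * of_int (power_sum (p - 3) (Suc r)))"
proof -
  have "pcong p 3 (\<Sum>c = 1..r. 2 * sq_prod (p - 1) (of_nat p * t + of_nat c))
      (\<Sum>c = 1..r. 2 * (of_nat p ^ 2 * (t * (t + 1) * of_int (int c ^ (p - 3)))))"
    using r by (intro pcong_sum[OF prime] pcong_mult_left[OF prime] sq_prod_cong t) auto
  also have "(\<Sum>c = 1..r. 2 * (of_nat p ^ 2 * (t * (t + 1) * of_int (int c ^ (p - 3)))))
      = 2 * of_nat p ^ 2 * (t * (t + 1)) * of_int (\<Sum>c = 1..r. int c ^ (p - 3))"
    by (simp add: sum_distrib_left mult_ac)
  also have "(\<Sum>c = 1..r. int c ^ (p - 3)) = power_sum (p - 3) (Suc r)"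
    unfolding power_sum_def lessThan_Suc_atMost atMost_atLeast0
    using p_gt_3 by (subst (2) sum.atLeast_Suc_atMost) (simp_all add: power_0_left)
  finally show ?thesis .
qed

text \<open>Going from pn to p(n+1), the residues c = 1, ..., p - 1 contribute p^2 times a full
  power sum, which is 0 modulo p^3, and c = p contributes 2.\<close>

lemma hyp_sum_nat_multiple:
  "pcong p 3 (hyp_sum p (of_nat p * of_nat n)) (1 + 2 * of_nat n)"
proof (induction n)
  case 0
  show ?case using hyp_sum_trivial(1)[of "p - 1"] p_gt_3 by simp
next
  case (Suc n)
  define b where "b = (of_nat p * of_nat n :: rat)"
  have sp: "Suc (p - 1) = p" using p_gt_3 by simp
  have b': "of_nat p * of_nat (Suc n) = b + of_nat p" by (simp add: b_def algebra_simps)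
  have "hyp_sum p (b + of_nat p) = hyp_sum p b + (\<Sum>c = 1..p. 2 * sq_prod (p - 1) (b + of_nat c))"
    using hyp_sum_add[of "p - 1" b p] unfolding sp .
  also have "(\<Sum>c = 1..p. 2 * sq_prod (p - 1) (b + of_nat c))
      = (\<Sum>c = 1..p - 1. 2 * sq_prod (p - 1) (b + of_nat c)) + 2 * sq_prod (p - 1) (b + of_nat p)"
    using sum.nat_ivl_Suc'[of 1 "p - 1" "\<lambda>c. 2 * sq_prod (p - 1) (b + of_nat c)"] p_gt_3 unfolding sp by simp
  finally have eq: "hyp_sum p (of_nat p * of_nat (Suc n)) = hyp_sum p b
      + ((\<Sum>c = 1..p - 1. 2 * sq_prod (p - 1) (b + of_nat c)) + 2 * sq_prod (p - 1) (of_nat p * of_nat (Suc n)))"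
    unfolding b' .
  obtain d where d: "power_sum (p - 3) p = int p * d"
    using power_sum_full[OF prime p_gt_3] by (auto simp: cong_0_iff elim: dvdE)
  have "pcong p 3 (\<Sum>c = 1..p - 1. 2 * sq_prod (p - 1) (b + of_nat c))
      (2 * of_nat p ^ 2 * (of_nat n * (of_nat n + 1)) * of_int (power_sum (p - 3) p))"
    unfolding b_def using sum_sq_prod_cong[of "of_nat n" "p - 1"] p_gt_3 unfolding sp by simp
  moreover have "pcong p 3 (2 * of_nat p ^ 2 * (of_nat n * (of_nat n + 1)) * of_int (power_sum (p - 3) p)) 0"
    unfolding pcong_def[OF prime] d
    by (intro exI[of _ "2 * (of_nat n * (of_nat n + 1)) * of_int d"]) (simp add: power_numeral_reduce mult_ac)
  ultimately have "pcong p 3 (\<Sum>c = 1..p - 1. 2 * sq_prod (p - 1) (b + of_nat c)) 0"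
    by (rule pcong_trans[OF prime])
  moreover have "pcong p 3 (2 * sq_prod (p - 1) (of_nat p * of_nat (Suc n))) (2 * 1)"
    by (intro pcong_mult_left[OF prime] sq_prod_multiple_p) (simp_all del: of_nat_Suc)
  ultimately have "pcong p 3 (hyp_sum p (of_nat p * of_nat (Suc n))) (1 + 2 * of_nat n + (0 + 2 * 1))"
    unfolding eq using Suc.IH unfolding b_def[symmetric] by (intro pcong_add[OF prime])
  then show ?case by (simp add: algebra_simps)
qed

lemma p_integral_inverse_2_3: "p_integral p (1 / 2)" "p_integral p (1 / 3)"
  using p_integral_inverse[OF prime, of 2] p_integral_inverse[OF prime, of 3]
    not_p_dvd_small[OF prime p_gt_3, of 2] not_p_dvd_small[OF prime p_gt_3, of 3] p_gt_3
  by auto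

text \<open>Passes from natural to p-integral t: the deviation from 1 + 2t is a cubic without
  constant term, so its values at 1, 2, 3 determine it, with interpolation denominators 2 and 6 that
  are units.\<close>

lemma hyp_sum_multiple:
  assumes t: "p_integral p t"
  shows "pcong p 3 (hyp_sum p (of_nat p * t)) (1 + 2 * t)"
proof -
  obtain c1 c2 c3 where c: "p_integral p c1" "p_integral p c2" "p_integral p c3"
    and exp: "\<And>t. p_integral p t \<Longrightarrow> pcong p 3 (hyp_sum p (of_nat p * t)) (1 + c1 * t + c2 * t ^ 2 + c3 * t ^ 3)"
    using hyp_sum_expansion by blast
  define e where "e t = (c1 - 2) * t + c2 * t ^ 2 + c3 * t ^ 3" for t
  have e: "pcong p 3 (e (of_nat n)) 0" for n
  proof -
    have "pcong p 3 (1 + c1 * of_nat n + c2 * of_nat n ^ 2 + c3 * of_nat n ^ 3) (1 + 2 * of_nat n)"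
      using pcong_trans[OF prime pcong_sym[OF prime exp] hyp_sum_nat_multiple[of n]] by simp
    from pcong_diff[OF prime this pcong_refl[OF prime, of _ "1 + 2 * of_nat n"]]
    show ?thesis by (simp add: e_def algebra_simps)
  qed
  \<comment> \<open>Lagrange interpolation at 0, 1, 2, 3\<close>
  define l1 l2 l3 where "l1 = t * (t - 2) * (t - 3) * (1 / 2)"
    and "l2 = - (t * (t - 1) * (t - 3) * (1 / 2))" and "l3 = t * (t - 1) * (t - 2) * (1 / 2) * (1 / 3)"
  have l: "p_integral p l1" "p_integral p l2" "p_integral p l3"
    unfolding l1_def l2_def l3_def 
    by (intro p_integral_mult[OF prime] p_integral_minus[OF prime] p_integral_diff[OF prime]
        p_integral_inverse_2_3 t p_integral_1[OF prime] p_integral_numeral[OF prime])+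
  have "e t = l1 * e (of_nat 1) + l2 * e (of_nat 2) + l3 * e (of_nat 3)"
    unfolding e_def l1_def l2_def l3_def by (simp add: field_simps power_numeral_reduce)
  also have "pcong p 3 \<dots> (l1 * 0 + l2 * 0 + l3 * 0)"
    by (intro pcong_add[OF prime] pcong_mult_left[OF prime] l e)
  finally have "pcong p 3 (e t + (1 + 2 * t)) (0 + (1 + 2 * t))"
    by (intro pcong_add[OF prime]) simp_all
  then have "pcong p 3 (1 + c1 * t + c2 * t ^ 2 + c3 * t ^ 3) (1 + 2 * t)"
    by (simp add: e_def algebra_simps)
  then show ?thesis using exp[OF t] pcong_trans[OF prime] by blast
qed

text \<open>The r unit steps from pt add 2 p^2 t(t+1) times a power sum congruent to 15 U modulo p;
  hence the 30.\<close>

lemma hyp_sum_cong: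
  assumes t: "p_integral p t" and r: "r < p" "p dvd 6 * r + 1"
  shows "pcong p 3 (hyp_sum p (of_nat p * t + of_nat r))
    (1 + 2 * t + 30 * of_nat p ^ 2 * (t * (t + 1)) * of_int (U (p - 3)))"
proof -
  have sp: "Suc (p - 1) = p" using p_gt_3 by simp
  have eq: "hyp_sum p (of_nat p * t + of_nat r)
      = hyp_sum p (of_nat p * t) + (\<Sum>c = 1..r. 2 * sq_prod (p - 1) (of_nat p * t + of_nat c))"
    using hyp_sum_add[of "p - 1" "of_nat p * t" r] unfolding sp .
  have "pcong p 1 (of_int (power_sum (p - 3) (Suc r))) (of_int (15 * U (p - 3)))"
    using power_sum_cong_U[OF prime p_gt_3 r] by (rule pcong_1_of_int[OF prime])
  then have "pcong p (2 + 1) (of_nat p ^ 2 * of_int (power_sum (p - 3) (Suc r))) (of_nat p ^ 2 * of_int (15 * U (p - 3)))"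
    by (rule pcong_power_mult[OF prime])
  moreover have "p_integral p (2 * (t * (t + 1)))" using t by simp
  ultimately have "pcong p (2 + 1) (2 * (t * (t + 1)) * (of_nat p ^ 2 * of_int (power_sum (p - 3) (Suc r))))
      (2 * (t * (t + 1)) * (of_nat p ^ 2 * of_int (15 * U (p - 3))))"
    using pcong_mult_left[OF prime] by blast
  moreover have "2 + 1 = (3 :: nat)"
    "2 * (t * (t + 1)) * (of_nat p ^ 2 * of_int (power_sum (p - 3) (Suc r)))
      = 2 * of_nat p ^ 2 * (t * (t + 1)) * of_int (power_sum (p - 3) (Suc r))"
    "2 * (t * (t + 1)) * (of_nat p ^ 2 * of_int (15 * U (p - 3)))
      = 30 * of_nat p ^ 2 * (t * (t + 1)) * of_int (U (p - 3))"
    by simp_all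
  ultimately have "pcong p 3 (2 * of_nat p ^ 2 * (t * (t + 1)) * of_int (power_sum (p - 3) (Suc r)))
      (30 * of_nat p ^ 2 * (t * (t + 1)) * of_int (U (p - 3)))"
    by (simp only:)
  from pcong_add[OF prime hyp_sum_multiple[OF t] pcong_trans[OF prime sum_sq_prod_cong[OF t r(1)] this]]
  show ?thesis unfolding eq .
qed

section \<open>The Legendre symbol and the residue of -1/6 modulo p\<close>

lemma not_3_dvd_p: "\<not> 3 dvd p"
proof
  assume "3 dvd p"
  then have "3 = (1 :: nat) \<or> 3 = p" using prime unfolding prime_nat_iff by blast
  then show False using p_gt_3 by simp
qed

lemma Legendre_3:
  "Legendre (int p) 3 = (if p mod 3 = 1 then 1 else - 1)"
proof -
  have "\<not> 3 dvd p" by (rule not_3_dvd_p)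
  then have cases: "p mod 3 = 1 \<or> p mod 3 = 2" by (auto simp: dvd_eq_mod_eq_0)
  have pmod: "int p mod 3 = int (p mod 3)" by (simp add: zmod_int)
  have "QuadRes 3 (int p)" if "p mod 3 = 1"
    unfolding QuadRes_def by (rule exI[of _ 1]) (simp add: cong_def pmod that)
  moreover have "\<not> QuadRes 3 (int p)" if p2: "p mod 3 = 2"
  proof
    assume "QuadRes 3 (int p)"
    then obtain y :: int where "y ^ 2 mod 3 = 2" by (auto simp: QuadRes_def cong_def pmod p2)
    moreover have "y ^ 2 mod 3 = (y mod 3) ^ 2 mod 3" by (simp add: power_mod)
    moreover have "y mod 3 = 0 \<or> y mod 3 = 1 \<or> y mod 3 = 2" by presburger
    ultimately show False by auto
  qed
  ultimately show ?thesis using cases by (auto simp: Legendre_def cong_def pmod)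
qed

text \<open>For p = 6q + 1 take t = -1/6, r = q; for p = 6q + 5 take t = -5/6, r = 5q + 4. These t
  are exchanged by t -> -1 - t, which fixes t(t+1) and negates 1 + 2t, whence the Legendre
  symbol.\<close>

lemma minus_sixth_decomposition:
  obtains t r where "p_integral p t" "r < p" "p dvd 6 * r + 1" "of_nat p * t + of_nat r = - 1 / 6"
    "1 + 2 * t = 2 / 3 * of_int (Legendre (int p) 3)" "t * (t + 1) = - 5 / 36"
proof -
  have sixth: "p_integral p (1 / 2 * (1 / 3))"
    by (intro p_integral_mult[OF prime] p_integral_inverse_2_3)
  have "odd p" using odd_p[OF prime p_gt_3] .
  moreover have "\<not> 3 dvd p" by (rule not_3_dvd_p)
  ultimately have "p mod 6 = 1 \<or> p mod 6 = 5" by presburger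
  then show thesis
  proof
    assume "p mod 6 = 1"
    then have p: "p = 6 * (p div 6) + 1" by presburger
    define q where "q = p div 6"
    have p: "p = 6 * q + 1" using p by (simp add: q_def)
    have "p mod 3 = 1" using p by presburger
    then show thesis
      using sixth p_integral_minus[OF prime sixth]
      by (intro that[of "- 1 / 6" q]) (simp_all add: Legendre_3, simp_all add: p field_simps)
  next
    assume "p mod 6 = 5"
    then have p: "p = 6 * (p div 6) + 5" by presburger
    define q where "q = p div 6"
    have p: "p = 6 * q + 5" using p by (simp add: q_def)
    have "p mod 3 \<noteq> 1" using p by presburger
    moreover have "6 * (5 * q + 4) + 1 = p * 5" using p by simp
    then have "p dvd 6 * (5 * q + 4) + 1" by (metis dvd_triv_left)
    ultimately show thesis
      using p_integral_mult[OF prime p_integral_of_int[OF prime, of "- 5"] sixth]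
      by (intro that[of "- 5 / 6" "5 * q + 4"]) (simp_all add: Legendre_3, simp_all add: p field_simps)
  qed
qed

end

theorem theorem3p4:
  fixes p :: nat
  assumes "prime p" and "p > 3"
  shows "rat_cong p 3
    (\<Sum>k = 0..p - 1. of_nat (((6 * k) choose (3 * k)) * ((3 * k) choose k))
        / (432 ^ k * (2 * of_nat k + 1)))
    (of_int (Legendre (int p) 3) - 25 / 4 * of_nat p ^ 2 * of_int (U (p - 3)))"
proof -
  let ?S = "\<Sum>k = 0..p - 1. of_nat (((6 * k) choose (3 * k)) * ((3 * k) choose k))
        / (432 ^ k * (2 * of_nat k + 1)) :: rat"
  let ?T = "of_int (Legendre (int p) 3) - 25 / 4 * of_nat p ^ 2 * of_int (U (p - 3)) :: rat"
  note p = assms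
  obtain t r where t: "p_integral p t" and r: "r < p" "p dvd 6 * r + 1" and a: "of_nat p * t + of_nat r = - 1 / 6"
    and t': "1 + 2 * t = 2 / 3 * of_int (Legendre (int p) 3)" "t * (t + 1) = - 5 / 36"
    by (rule minus_sixth_decomposition[OF p])
  have "{0..p - 1} = {..<p}" using p by auto
  then have "?S = (\<Sum>k<p. hyp_term (- 1 / 6) k / (2 * of_nat k + 1))"
    unfolding hyp_term_minus_sixth divide_divide_eq_left by simp
  \<comment> \<open>At a = -1/6 the factor 2a + 1 is 2/3.\<close>
  then have S: "?S = 3 * (1 / 2) * hyp_sum p (- 1 / 6)"
    by (simp add: hyp_sum_def)
  have half: "p_integral p (1 / 2)" by (rule p_integral_inverse_2_3[OF p])
  have "pcong p 3 (3 * (1 / 2) * hyp_sum p (- 1 / 6))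
      (3 * (1 / 2) * (1 + 2 * t + 30 * of_nat p ^ 2 * (t * (t + 1)) * of_int (U (p - 3))))"
    using hyp_sum_cong[OF p t r] half
    by (intro pcong_mult_left[OF p(1)] p_integral_mult[OF p(1)] p_integral_numeral[OF p(1)]) (simp_all add: a)
  \<comment> \<open>The constants combine as 3/2 * 2/3 = 1 and 3/2 * 30 * (-5/36) = -25/4.\<close>
  then have ST: "pcong p 3 ?S ?T"
    unfolding S t' by (simp add: algebra_simps)
  have T: "p_integral p ?T"
  proof -
    have "?T = of_int (Legendre (int p) 3) - 25 * (1 / 2) * (1 / 2) * of_nat p ^ 2 * of_int (U (p - 3))"
      by simp
    then show ?thesis using half p(1) by (simp only: p_integral_diff p_integral_mult p_integral_power
          p_integral_of_int p_integral_of_nat p_integral_numeral)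
  qed
  \<comment> \<open>Integrality of the sum, despite its term with denominator factor 2k + 1 = p, is
    inherited from the right-hand side through the congruence.\<close>
  obtain z where "p_integral p z" "?S = ?T + of_nat p ^ 3 * z"
    using ST unfolding pcong_def[OF p(1)] by blast
  then have "p_integral p ?S"
    using T p(1) by (simp only: p_integral_add p_integral_mult p_integral_power p_integral_of_nat)
  then show ?thesis
    unfolding rat_cong_def using T ST unfolding pcong_iff[OF p(1)] by blast
qed

end
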